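(* Let $R^{(1)},R^{(2)}$ be embeddings of the pair $(X,A)$ satisfying $$R^{(2)}\perp\!\!\!\perp (X,A)\mid R^{(1)}\qquad\text{and}\qquad Y\perp\!\!\!\perp (R^{(1)},X,A)\mid R^{(2)} .$$ Suppose the ratios $\rho(a,x)$, $w(y)$ and $\frac{p_{\pi^*}(r^{(j)})}{p_{\pi^b}(r^{(j)})}$, $j\in\{1,2\}$, are known exactly. Let $$\hat\theta_{\mathrm{IPW}}=\frac1n\sum_{i=1}^n\rho(a_i,x_i)\,y_i,\quad \hat\theta^{(j)}_{\mathrm{G\text{-}MIPS}}=\frac1n\sum_{i=1}^n\frac{p_{\pi^*}(r_i^{(j)})}{p_{\pi^b}(r_i^{(j)})}\,y_i\ (j\in\{1,2\}),\quad \hat\theta_{\mathrm{MR}}=\frac1n\sum_{i=1}^n w(y_i)\,y_i .$$ Then $$\mathbb E_{\pi^b}[\hat\theta_{\mathrm{IPW}}]=\mathbb E_{\pi^b}[\hat\theta^{(1)}_{\mathrm{G\text{-}MIPS}}]=\mathbb E_{\pi^b}[\hat\theta^{(2)}_{\mathrm{G\text{-}MIPS}}]=\mathbb E_{\pi^b}[\hat\theta_{\mathrm{MR}}]=\mathbb E_{\pi^*}[Y],$$ and moreover $$\mathrm{Var}_{\pi^b}[\hat\theta_{\mathrm{IPW}}]\ge\mathrm{Var}_{\pi^b}[\hat\theta^{(1)}_{\mathrm{G\text{-}MIPS}}]\ge\mathrm{Var}_{\pi^b}[\hat\theta^{(2)}_{\mathrm{G\text{-}MIPS}}]\ge\ma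thrm{Var}_{\pi^b}[\hat\theta_{\mathrm{MR}}].$$
   Context: Contextual bandit setting with embeddings. $X\in\mathcal X$ is a context, $A\in\mathcal A$ an action, $Y\in\mathcal Y\subseteq\mathbb R$ a scalar outcome, and $R^{(1)},R^{(2)}$ are embeddings of $(X,A)$. The conditional independences correspond to the Bayesian network $(X,A)\to R^{(1)}\to R^{(2)}\to Y$: under a policy $\pi(a\mid x)$ the joint density is $p_\pi(x,a,r^{(1)},r^{(2)},y)=p(x)\,\pi(a\mid x)\,p(r^{(1)}\mid x,a)\,p(r^{(2)}\mid r^{(1)})\,p(y\mid r^{(2)})$ (densities with respect to fixed reference measures), where only $\pi$ depends on the policy. $p_\pi(r^{(j)})$ and $p_\pi(y)$ denote the marginal densities of $R^{(j)}$ and $Y$; $\mathbb E_\pi$, $\mathrm{Var}_\pi$ denote expectation and variance under $p_\pi$. There is a behaviour policy $\pi^b$ and a target policy $\pi^*$; the data $(x_i,a_i,r^{(1)}_i,r^{(2)}_i,y_i)_{i=1}^n$ are i.i.d. from $p_{\pi^b}$, and expectations/variances of estimators are over this data. Define $\rho(a,x)=\pi^*(a\mid x)/\pi^b(a\mid x)$ and $w(y)=p_{\pi^*}(y)/p_{\pi^b}(y)$. Standing assumption (support): for all $x\in\mathcal X,a\in\mathcal A$, $\pi^*(a\mid x)>0\implies\pi^b(a\mid x)>0$. All expectations and variances appearing are implicitly assumed to exist and be finite. *)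

theory Defs
  imports "HOL-Probability.Probability"
begin

text \<open>
  A contextual bandit with two embeddings and the Bayesian network
  \<open>(X, A) \<rightarrow> R1 \<rightarrow> R2 \<rightarrow> Y\<close>: the reference measures, and the conditional densities that do
  not depend on the policy. The context, action, embedding and outcome spaces are the spaces of
  the reference measures; conditional densities take the conditioning variables first, so
  \<open>emb1_dens B x a r\<close> is \<open>p(r | x, a)\<close>.
\<close>

record ('x, 'a, 'r, 's) bandit =
  ctx_ref :: "'x measure"
  act_ref :: "'a measure"
  emb1_ref :: "'r measure"
  emb2_ref :: "'s measure"
  out_ref :: "real measure"
  ctx_dens :: "'x \<Rightarrow> real"
  emb1_dens :: "'x \<Rightarrow> 'a \<Rightarrow> 'r \<Rightarrow> real"
  emb2_dens :: "'r \<Rightarrow> 's \<Rightarrow> real"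
  out_dens :: "'s \<Rightarrow> real \<Rightarrow> real"

definition cond_density :: "'u measure \<Rightarrow> 'v measure \<Rightarrow> ('u \<Rightarrow> 'v \<Rightarrow> real) \<Rightarrow> bool" where
  "cond_density U V q \<longleftrightarrow>
     case_prod q \<in> borel_measurable (U \<Otimes>\<^sub>M V) \<and>
     (\<forall>u\<in>space U. (\<forall>v\<in>space V. 0 \<le> q u v) \<and> (\<integral>\<^sup>+v. ennreal (q u v) \<partial>V) = 1)"

text \<open>The condition on the sets of \<open>out_ref\<close> says that the outcome space is an arbitrary
  subset of the reals, with the trace of the Borel sets.\<close>

definition wf_bandit :: "('x, 'a, 'r, 's) bandit \<Rightarrow> bool" where
  "wf_bandit B \<longleftrightarrow>
     sigma_finite_measure (ctx_ref B) \<and> sigma_finite_measure (act_ref B) \<and>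
     sigma_finite_measure (emb1_ref B) \<and> sigma_finite_measure (emb2_ref B) \<and>
     sigma_finite_measure (out_ref B) \<and>
     sets (out_ref B) = sets (restrict_space borel (space (out_ref B))) \<and>
     ctx_dens B \<in> borel_measurable (ctx_ref B) \<and>
     (\<forall>x\<in>space (ctx_ref B). 0 \<le> ctx_dens B x) \<and>
     (\<integral>\<^sup>+x. ennreal (ctx_dens B x) \<partial>ctx_ref B) = 1 \<and>
     cond_density (ctx_ref B \<Otimes>\<^sub>M act_ref B) (emb1_ref B) (\<lambda>(x, a). emb1_dens B x a) \<and>
     cond_density (emb1_ref B) (emb2_ref B) (emb2_dens B) \<and>
     cond_density (emb2_ref B) (out_ref B) (out_dens B)"

text \<open>A policy is a conditional density, \<open>\<pi> x a\<close> standing for \<open>\<pi>(a | x)\<close>.\<close>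

definition policy :: "('x, 'a, 'r, 's) bandit \<Rightarrow> ('x \<Rightarrow> 'a \<Rightarrow> real) \<Rightarrow> bool" where
  "policy B \<pi> \<longleftrightarrow> cond_density (ctx_ref B) (act_ref B) \<pi>"

definition policy_support ::
    "('x, 'a, 'r, 's) bandit \<Rightarrow> ('x \<Rightarrow> 'a \<Rightarrow> real) \<Rightarrow> ('x \<Rightarrow> 'a \<Rightarrow> real) \<Rightarrow> bool" where
  "policy_support B \<pi>t \<pi>b \<longleftrightarrow>
     (\<forall>x\<in>space (ctx_ref B). \<forall>a\<in>space (act_ref B). \<pi>t x a > 0 \<longrightarrow> \<pi>b x a > 0)"

definition joint_ref ::
    "('x, 'a, 'r, 's) bandit \<Rightarrow> ('x \<times> 'a \<times> 'r \<times> 's \<times> real) measure" where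
  "joint_ref B =
     ctx_ref B \<Otimes>\<^sub>M act_ref B \<Otimes>\<^sub>M emb1_ref B \<Otimes>\<^sub>M emb2_ref B \<Otimes>\<^sub>M out_ref B"

text \<open>The conditional independences of \<open>R2\<close> and \<open>(X, A)\<close> given \<open>R1\<close>, and of \<open>Y\<close> and
  \<open>(R1, X, A)\<close> given \<open>R2\<close>, are the factorization of the joint density along the network;
  they are derived from it in \<open>joint_dens_cond_indep1\<close> and \<open>joint_dens_cond_indep2\<close> below.\<close>

definition joint_dens ::
    "('x, 'a, 'r, 's) bandit \<Rightarrow> ('x \<Rightarrow> 'a \<Rightarrow> real) \<Rightarrow> 'x \<times> 'a \<times> 'r \<times> 's \<times> real \<Rightarrow> ennreal" where
  "joint_dens B \<pi> = (\<lambda>(x, a, r, s, y).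
     ennreal (ctx_dens B x * \<pi> x a * emb1_dens B x a r * emb2_dens B r s * out_dens B s y))"

definition joint_law ::
    "('x, 'a, 'r, 's) bandit \<Rightarrow> ('x \<Rightarrow> 'a \<Rightarrow> real) \<Rightarrow> ('x \<times> 'a \<times> 'r \<times> 's \<times> real) measure" where
  "joint_law B \<pi> = density (joint_ref B) (joint_dens B \<pi>)"

definition emb1_marg ::
    "('x, 'a, 'r, 's) bandit \<Rightarrow> ('x \<Rightarrow> 'a \<Rightarrow> real) \<Rightarrow> 'r \<Rightarrow> ennreal" where
  "emb1_marg B \<pi> r =
     (\<integral>\<^sup>+(x, a, s, y). joint_dens B \<pi> (x, a, r, s, y)
        \<partial>(ctx_ref B \<Otimes>\<^sub>M act_ref B \<Otimes>\<^sub>M emb2_ref B \<Otimes>\<^sub>M out_ref B))"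

definition emb2_marg ::
    "('x, 'a, 'r, 's) bandit \<Rightarrow> ('x \<Rightarrow> 'a \<Rightarrow> real) \<Rightarrow> 's \<Rightarrow> ennreal" where
  "emb2_marg B \<pi> s =
     (\<integral>\<^sup>+(x, a, r, y). joint_dens B \<pi> (x, a, r, s, y)
        \<partial>(ctx_ref B \<Otimes>\<^sub>M act_ref B \<Otimes>\<^sub>M emb1_ref B \<Otimes>\<^sub>M out_ref B))"

definition out_marg ::
    "('x, 'a, 'r, 's) bandit \<Rightarrow> ('x \<Rightarrow> 'a \<Rightarrow> real) \<Rightarrow> real \<Rightarrow> ennreal" where
  "out_marg B \<pi> y =
     (\<integral>\<^sup>+(x, a, r, s). joint_dens B \<pi> (x, a, r, s, y)
        \<partial>(ctx_ref B \<Otimes>\<^sub>M act_ref B \<Otimes>\<^sub>M emb1_ref B \<Otimes>\<^sub>M emb2_ref B))"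

text \<open>Marginal densities are finite almost everywhere, and the denominators below vanish only on
  null sets of the behaviour law, so neither the truncation by \<^term>\<open>enn2real\<close> nor division by
  zero affects the estimators. The first policy is the target, the second the behaviour policy.\<close>

definition policy_ratio ::
    "('x \<Rightarrow> 'a \<Rightarrow> real) \<Rightarrow> ('x \<Rightarrow> 'a \<Rightarrow> real) \<Rightarrow> 'a \<Rightarrow> 'x \<Rightarrow> real" where
  "policy_ratio \<pi>t \<pi>b a x = \<pi>t x a / \<pi>b x a"

definition emb1_ratio where
  "emb1_ratio B \<pi>t \<pi>b r = enn2real (emb1_marg B \<pi>t r) / enn2real (emb1_marg B \<pi>b r)"

definition emb2_ratio where
  "emb2_ratio B \<pi>t \<pi>b s = enn2real (emb2_marg B \<pi>t s) / enn2real (emb2_marg B \<pi>b s)"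

definition out_ratio where
  "out_ratio B \<pi>t \<pi>b y = enn2real (out_marg B \<pi>t y) / enn2real (out_marg B \<pi>b y)"

definition iid_sample ::
    "('x, 'a, 'r, 's) bandit \<Rightarrow> ('x \<Rightarrow> 'a \<Rightarrow> real) \<Rightarrow> nat \<Rightarrow> 'w measure \<Rightarrow>
      (nat \<Rightarrow> 'w \<Rightarrow> 'x \<times> 'a \<times> 'r \<times> 's \<times> real) \<Rightarrow> bool" where
  "iid_sample B \<pi> n M Z \<longleftrightarrow>
     prob_space M \<and>
     prob_space.indep_vars M (\<lambda>_. joint_ref B) Z {1..n} \<and>
     (\<forall>i\<in>{1..n}. distributed M (joint_ref B) (Z i) (joint_dens B \<pi>))"

definition theta_IPW where
  "theta_IPW \<pi>t \<pi>b n Z \<omega> =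
     (1 / real n) * (\<Sum>i=1..n. case Z i \<omega> of (x, a, r, s, y) \<Rightarrow> policy_ratio \<pi>t \<pi>b a x * y)"

definition theta_GMIPS1 where
  "theta_GMIPS1 B \<pi>t \<pi>b n Z \<omega> =
     (1 / real n) * (\<Sum>i=1..n. case Z i \<omega> of (x, a, r, s, y) \<Rightarrow> emb1_ratio B \<pi>t \<pi>b r * y)"

definition theta_GMIPS2 where
  "theta_GMIPS2 B \<pi>t \<pi>b n Z \<omega> =
     (1 / real n) * (\<Sum>i=1..n. case Z i \<omega> of (x, a, r, s, y) \<Rightarrow> emb2_ratio B \<pi>t \<pi>b s * y)"

definition theta_MR where
  "theta_MR B \<pi>t \<pi>b n Z \<omega> =
     (1 / real n) * (\<Sum>i=1..n. case Z i \<omega> of (x, a, r, s, y) \<Rightarrow> out_ratio B \<pi>t \<pi>b y * y)"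

definition finite_mean_var :: "'w measure \<Rightarrow> ('w \<Rightarrow> real) \<Rightarrow> bool" where
  "finite_mean_var M T \<longleftrightarrow> integrable M T \<and> integrable M (\<lambda>\<omega>. (T \<omega>)\<^sup>2)"

text \<open>Conditional independence of \<open>U\<close> and \<open>V\<close> given \<open>W\<close> for a joint density \<open>f\<close>:
  \<open>p(u, v, w) p(w) = p(u, w) p(v, w)\<close>.\<close>

definition cond_indep_dens ::
    "'u measure \<Rightarrow> 'v measure \<Rightarrow> 'w measure \<Rightarrow> ('u \<Rightarrow> 'v \<Rightarrow> 'w \<Rightarrow> ennreal) \<Rightarrow> bool" where
  "cond_indep_dens U V W f \<longleftrightarrow>
     (\<forall>u\<in>space U. \<forall>v\<in>space V. \<forall>w\<in>space W.
        f u v w * (\<integral>\<^sup>+u'. (\<integral>\<^sup>+v'. f u' v' w \<partial>V) \<partial>U) =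
        (\<integral>\<^sup>+v'. f u v' w \<partial>V) * (\<integral>\<^sup>+u'. f u' v w \<partial>U))"

lemma cond_indep_densI:
  assumes q: "cond_density W V q"
    and g: "\<And>w. w \<in> space W \<Longrightarrow> (\<lambda>u. g u w) \<in> borel_measurable U"
    and f: "\<And>u v w. u \<in> space U \<Longrightarrow> v \<in> space V \<Longrightarrow> w \<in> space W \<Longrightarrow>
              f u v w = g u w * ennreal (q w v)"
  shows "cond_indep_dens U V W f"
  unfolding cond_indep_dens_def
proof (intro ballI)
  fix u v w assume u: "u \<in> space U" and v: "v \<in> space V" and w: "w \<in> space W"
  have q1: "(\<integral>\<^sup>+v'. ennreal (q w v') \<partial>V) = 1"
    using q w by (auto simp: cond_density_def)
  have [measurable]: "case_prod q \<in> borel_measurable (W \<Otimes>\<^sub>M V)"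
    using q by (auto simp: cond_density_def)
  have qm: "(\<lambda>v'. ennreal (q w v')) \<in> borel_measurable V"
    using w by measurable
  have fv: "(\<integral>\<^sup>+v'. f u' v' w \<partial>V) = g u' w" if "u' \<in> space U" for u'
  proof -
    have "(\<integral>\<^sup>+v'. f u' v' w \<partial>V) = (\<integral>\<^sup>+v'. g u' w * ennreal (q w v') \<partial>V)"
      using that w by (intro nn_integral_cong) (simp add: f)
    then show ?thesis by (simp add: nn_integral_cmult qm q1)
  qed
  have "(\<integral>\<^sup>+u'. f u' v w \<partial>U) = (\<integral>\<^sup>+u'. g u' w * ennreal (q w v) \<partial>U)"
    using v w by (intro nn_integral_cong) (simp add: f)
  also have "\<dots> = (\<integral>\<^sup>+u'. g u' w \<partial>U) * ennreal (q w v)"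
    by (rule nn_integral_multc) (rule g[OF w])
  finally have fu: "(\<integral>\<^sup>+u'. f u' v w \<partial>U) = (\<integral>\<^sup>+u'. g u' w \<partial>U) * ennreal (q w v)" .
  have "(\<integral>\<^sup>+u'. (\<integral>\<^sup>+v'. f u' v' w \<partial>V) \<partial>U) = (\<integral>\<^sup>+u'. g u' w \<partial>U)"
    by (intro nn_integral_cong) (simp add: fv)
  then show "f u v w * (\<integral>\<^sup>+u'. (\<integral>\<^sup>+v'. f u' v' w \<partial>V) \<partial>U) =
      (\<integral>\<^sup>+v'. f u v' w \<partial>V) * (\<integral>\<^sup>+u'. f u' v w \<partial>U)"
    by (simp add: fu fv u f[OF u v w] mult_ac)
qed

lemma joint_dens_cond_indep1:
  assumes B: "wf_bandit B" and P: "policy B \<pi>"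
  shows "cond_indep_dens (ctx_ref B \<Otimes>\<^sub>M act_ref B) (emb2_ref B) (emb1_ref B)
           (\<lambda>(x, a) s r. \<integral>\<^sup>+y. joint_dens B \<pi> (x, a, r, s, y) \<partial>out_ref B)"
proof (rule cond_indep_densI[where q = "emb2_dens B" and
      g = "\<lambda>(x, a) r. ennreal (ctx_dens B x * \<pi> x a * emb1_dens B x a r)"])
  show "cond_density (emb1_ref B) (emb2_ref B) (emb2_dens B)"
    using B by (simp add: wf_bandit_def)
next
  fix r assume r: "r \<in> space (emb1_ref B)"
  have [measurable]: "ctx_dens B \<in> borel_measurable (ctx_ref B)"
    "case_prod \<pi> \<in> borel_measurable (ctx_ref B \<Otimes>\<^sub>M act_ref B)"
    "(\<lambda>((x, a), r). emb1_dens B x a r)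
      \<in> borel_measurable ((ctx_ref B \<Otimes>\<^sub>M act_ref B) \<Otimes>\<^sub>M emb1_ref B)"
    using B P by (auto simp: wf_bandit_def policy_def cond_density_def case_prod_unfold)
  have [measurable]: "(\<lambda>(x, a). emb1_dens B x a r) \<in> borel_measurable (ctx_ref B \<Otimes>\<^sub>M act_ref B)"
    using measurable_compose[OF measurable_Pair2'[OF r]
        \<open>(\<lambda>((x, a), r). emb1_dens B x a r) \<in> _\<close>] by (simp add: case_prod_unfold)
  show "(\<lambda>u. (case u of (x, a) \<Rightarrow> \<lambda>r. ennreal (ctx_dens B x * \<pi> x a * emb1_dens B x a r)) r)
      \<in> borel_measurable (ctx_ref B \<Otimes>\<^sub>M act_ref B)"
  proof -
    have "(\<lambda>u. ennreal (ctx_dens B (fst u) * case_prod \<pi> u * (case u of (x, a) \<Rightarrow> emb1_dens B x a r)))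
      \<in> borel_measurable (ctx_ref B \<Otimes>\<^sub>M act_ref B)" by measurable
    then show ?thesis by (simp add: case_prod_unfold)
  qed
next
  fix u s r
  assume u: "u \<in> space (ctx_ref B \<Otimes>\<^sub>M act_ref B)" and s: "s \<in> space (emb2_ref B)"
    and r: "r \<in> space (emb1_ref B)"
  obtain x a where ua: "u = (x, a)" by force
  have xa: "x \<in> space (ctx_ref B)" "a \<in> space (act_ref B)"
    using u ua by (auto simp: space_pair_measure)
  have nn: "0 \<le> ctx_dens B x" "0 \<le> \<pi> x a" "0 \<le> emb1_dens B x a r" "0 \<le> emb2_dens B r s"
    using B P xa u ua r s by (auto simp: wf_bandit_def policy_def cond_density_def)
  have q: "(\<integral>\<^sup>+y. ennreal (out_dens B s y) \<partial>out_ref B) = 1"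
    and [measurable]: "case_prod (out_dens B) \<in> borel_measurable (emb2_ref B \<Otimes>\<^sub>M out_ref B)"
    using B s by (auto simp: wf_bandit_def cond_density_def)
  have qm: "(\<lambda>y. ennreal (out_dens B s y)) \<in> borel_measurable (out_ref B)"
    using s by measurable
  have "(\<integral>\<^sup>+y. joint_dens B \<pi> (x, a, r, s, y) \<partial>out_ref B) =
      (\<integral>\<^sup>+y. ennreal (ctx_dens B x * \<pi> x a * emb1_dens B x a r * emb2_dens B r s) *
        ennreal (out_dens B s y) \<partial>out_ref B)"
    using nn by (intro nn_integral_cong) (simp add: joint_dens_def ennreal_mult')
  also have "\<dots> = ennreal (ctx_dens B x * \<pi> x a * emb1_dens B x a r) * ennreal (emb2_dens B r s)"
    using nn by (simp add: nn_integral_cmult qm q ennreal_mult')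
  finally show "(case u of (x, a) \<Rightarrow> \<lambda>s r. \<integral>\<^sup>+y. joint_dens B \<pi> (x, a, r, s, y) \<partial>out_ref B) s r =
      (case u of (x, a) \<Rightarrow> \<lambda>r. ennreal (ctx_dens B x * \<pi> x a * emb1_dens B x a r)) r *
      ennreal (emb2_dens B r s)"
    by (simp add: ua)
qed

lemma joint_dens_cond_indep2:
  assumes B: "wf_bandit B" and P: "policy B \<pi>"
  shows "cond_indep_dens ((ctx_ref B \<Otimes>\<^sub>M act_ref B) \<Otimes>\<^sub>M emb1_ref B) (out_ref B) (emb2_ref B)
           (\<lambda>((x, a), r) y s. joint_dens B \<pi> (x, a, r, s, y))"
proof (rule cond_indep_densI[where q = "out_dens B" and
      g = "\<lambda>((x, a), r) s. ennreal (ctx_dens B x * \<pi> x a * emb1_dens B x a r * emb2_dens B r s)"])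
  show "cond_density (emb2_ref B) (out_ref B) (out_dens B)"
    using B by (simp add: wf_bandit_def)
next
  fix s assume s: "s \<in> space (emb2_ref B)"
  let ?U = "(ctx_ref B \<Otimes>\<^sub>M act_ref B) \<Otimes>\<^sub>M emb1_ref B"
  have [measurable]: "ctx_dens B \<in> borel_measurable (ctx_ref B)"
    "case_prod \<pi> \<in> borel_measurable (ctx_ref B \<Otimes>\<^sub>M act_ref B)"
    "(\<lambda>((x, a), r). emb1_dens B x a r) \<in> borel_measurable ?U"
    and m: "case_prod (emb2_dens B) \<in> borel_measurable (emb1_ref B \<Otimes>\<^sub>M emb2_ref B)"
    using B P by (auto simp: wf_bandit_def policy_def cond_density_def case_prod_unfold)
  have [measurable]: "(\<lambda>r. emb2_dens B r s) \<in> borel_measurable (emb1_ref B)"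
    using measurable_compose[OF measurable_Pair2'[OF s] m] by simp
  have [measurable]: "(\<lambda>u. emb2_dens B (snd u) s) \<in> borel_measurable ?U"
    by (rule measurable_compose[OF measurable_snd]) measurable
  have e: "(\<lambda>u. emb1_dens B (fst (fst u)) (snd (fst u)) (snd u)) \<in> borel_measurable ?U"
    using \<open>(\<lambda>((x, a), r). emb1_dens B x a r) \<in> borel_measurable ?U\<close> by (simp add: case_prod_unfold)
  note e [measurable]
  have "(\<lambda>u. ennreal (ctx_dens B (fst (fst u)) * case_prod \<pi> (fst u) *
      emb1_dens B (fst (fst u)) (snd (fst u)) (snd u) * emb2_dens B (snd u) s))
    \<in> borel_measurable ?U" by measurable
  then show "(\<lambda>u. (\<lambda>((x, a), r) s.
      ennreal (ctx_dens B x * \<pi> x a * emb1_dens B x a r * emb2_dens B r s)) u s)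
      \<in> borel_measurable ?U" by (simp add: case_prod_unfold)
next
  fix u y s
  assume u: "u \<in> space ((ctx_ref B \<Otimes>\<^sub>M act_ref B) \<Otimes>\<^sub>M emb1_ref B)"
    and y: "y \<in> space (out_ref B)" and s: "s \<in> space (emb2_ref B)"
  obtain x a r where ua: "u = ((x, a), r)" by (metis surj_pair)
  have sp: "x \<in> space (ctx_ref B)" "a \<in> space (act_ref B)" "r \<in> space (emb1_ref B)"
    using u ua by (auto simp: space_pair_measure)
  have nn: "0 \<le> ctx_dens B x" "0 \<le> \<pi> x a" "0 \<le> emb1_dens B x a r" "0 \<le> emb2_dens B r s"
    using B P sp s by (auto simp: wf_bandit_def policy_def cond_density_def space_pair_measure)
  show "(\<lambda>((x, a), r) y s. joint_dens B \<pi> (x, a, r, s, y)) u y s =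
      (\<lambda>((x, a), r) s.
        ennreal (ctx_dens B x * \<pi> x a * emb1_dens B x a r * emb2_dens B r s)) u s *
      ennreal (out_dens B s y)"
    using nn by (simp add: ua joint_dens_def ennreal_mult')
qed

end

theory Submission
  imports Defs
begin

text \<open>
  Let \<open>W0 = \<rho>\<close>, \<open>W1\<close>, \<open>W2\<close>, \<open>W3\<close> be the weights of the four estimators. Each \<open>Wj\<close> is the density
  ratio of the target law to the behaviour law on the sigma-algebra of \<open>(X, A, R1, R2, Y)\<close>,
  \<open>(R1, R2, Y)\<close>, \<open>(R2, Y)\<close>, \<open>Y\<close> respectively: by the Markov structure the conditional law of the later
  variables does not depend on the policy, so the ratio reduces to that of the first variable. Thus
  \<open>E_b[Wj \<phi>] = E_t[\<phi>]\<close> for every \<open>\<phi>\<close> depending only on those variables. Taking \<open>\<phi> = Y\<close> gives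
  unbiasedness, and \<open>\<phi> = W(j+1) Y^2\<close> gives \<open>E_b[Wj W(j+1) Y^2] = E_b[(W(j+1) Y)^2]\<close>, whence
  \<open>E_b[(W(j+1) Y)^2] \<le> E_b[(Wj Y)^2]\<close> by \<open>2uv \<le> u^2 + v^2\<close>. The variances of the sample means follow,
  since square integrability of a mean of independent terms passes to the single terms.
\<close>

section \<open>Means of independent samples\<close>

text \<open>The finiteness hypothesis of the theorem concerns whole sample means. This lemma
  recovers the second moment of one summand from that of a sum of two independent ones, without any
  moment assumption on either.\<close>

lemma (in prob_space) indep_var_square_integrable:
  fixes X Y :: "'a \<Rightarrow> real"
  assumes ind: "indep_var borel X borel Y" and sq: "integrable M (\<lambda>\<omega>. (X \<omega> + Y \<omega>)\<^sup>2)"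
  shows "integrable M (\<lambda>\<omega>. (X \<omega>)\<^sup>2)"
proof -
  have [measurable]: "random_variable borel X" "random_variable borel Y"
    and eq: "distr M borel X \<Otimes>\<^sub>M distr M borel Y = distr M (borel \<Otimes>\<^sub>M borel) (\<lambda>\<omega>. (X \<omega>, Y \<omega>))"
    using ind by (auto simp: indep_var_distribution_eq)
  interpret X: prob_space "distr M borel X" by (rule prob_space_distr) measurable
  interpret Y: prob_space "distr M borel Y" by (rule prob_space_distr) measurable
  interpret XY: pair_sigma_finite "distr M borel X" "distr M borel Y" ..
  \<comment> \<open>By Fubini, \<open>X + y\<close> is square integrable for almost every value \<open>y\<close> of \<open>Y\<close>; one such value is enough.\<close>
  have "(\<integral>\<^sup>+y. \<integral>\<^sup>+x. ennreal ((x + y)\<^sup>2) \<partial>distr M borel X \<partial>distr M borel Y)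
      = (\<integral>\<^sup>+z. ennreal ((fst z + snd z)\<^sup>2) \<partial>(distr M borel X \<Otimes>\<^sub>M distr M borel Y))"
    using XY.nn_integral_snd[of "\<lambda>z. ennreal ((fst z + snd z)\<^sup>2)"] by simp
  also have "\<dots> = (\<integral>\<^sup>+\<omega>. ennreal ((X \<omega> + Y \<omega>)\<^sup>2) \<partial>M)"
    unfolding eq by (subst nn_integral_distr) simp_all
  also have "\<dots> < \<infinity>"
    using sq by (simp add: integrable_iff_bounded)
  finally have "AE y in distr M borel Y. (\<integral>\<^sup>+x. ennreal ((x + y)\<^sup>2) \<partial>distr M borel X) \<noteq> \<infinity>"
    by (intro nn_integral_noteq_infinite) (simp_all add: less_top)
  then have "\<exists>y. (\<integral>\<^sup>+x. ennreal ((x + y)\<^sup>2) \<partial>distr M borel X) \<noteq> \<infinity>"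
    using Y.AE_False[THEN iffD1, OF eventually_mono] by blast
  then obtain y where "(\<integral>\<^sup>+x. ennreal ((x + y)\<^sup>2) \<partial>distr M borel X) \<noteq> \<infinity>" ..
  then have "integrable M (\<lambda>\<omega>. (X \<omega> + y)\<^sup>2)"
    by (subst (asm) nn_integral_distr) (simp_all add: integrable_iff_bounded less_top)
  \<comment> \<open>This is the dominating function: \<open>2 * (x + y)^2 + 2 * y^2 - x^2\<close>
    equals \<open>(x + 2 * y)^2\<close>, so it bounds \<open>x^2\<close>.\<close>
  then have "integrable M (\<lambda>\<omega>. 2 * (X \<omega> + y)\<^sup>2 + 2 * y\<^sup>2)"
    by simp
  then show ?thesis
  proof (rule Bochner_Integration.integrable_bound)
    have "x\<^sup>2 \<le> 2 * (x + y)\<^sup>2 + 2 * y\<^sup>2" for x :: real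
      using zero_le_power2[of "x + 2 * y"] by (simp add: power2_eq_square algebra_simps)
    then show "AE \<omega> in M. norm ((X \<omega>)\<^sup>2) \<le> norm (2 * (X \<omega> + y)\<^sup>2 + 2 * y\<^sup>2)"
      by simp
  qed measurable
qed

text \<open>One term is independent of the sum of all the others, so the case of two variables
  applies.\<close>

lemma (in prob_space) indep_vars_square_integrable:
  fixes X :: "'i \<Rightarrow> 'a \<Rightarrow> real"
  assumes "finite I" "indep_vars (\<lambda>_. borel) X I" "i \<in> I"
    and sq: "integrable M (\<lambda>\<omega>. (\<Sum>i\<in>I. X i \<omega>)\<^sup>2)"
  shows "integrable M (\<lambda>\<omega>. (X i \<omega>)\<^sup>2)"
proof (rule indep_var_square_integrable)
  show "indep_var borel (X i) borel (\<lambda>\<omega>. \<Sum>j\<in>I - {i}. X j \<omega>)"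
    using assms indep_vars_sum[of "I - {i}" i X] by (simp add: insert_absorb)
  show "integrable M (\<lambda>\<omega>. (X i \<omega> + (\<Sum>j\<in>I - {i}. X j \<omega>))\<^sup>2)"
    using sq by (simp add: sum.remove[OF assms(1,3)])
qed

lemma (in prob_space) expectation_indep_mult:
  fixes X :: "'i \<Rightarrow> 'a \<Rightarrow> real"
  assumes "indep_vars (\<lambda>_. borel) X I" "i \<in> I" "j \<in> I" "i \<noteq> j"
    and "integrable M (X i)" "integrable M (X j)"
  shows "integrable M (\<lambda>\<omega>. X i \<omega> * X j \<omega>)"
    and "expectation (\<lambda>\<omega>. X i \<omega> * X j \<omega>) = expectation (X i) * expectation (X j)"
proof -
  have "indep_vars (\<lambda>_. borel) X {i, j}"
    using assms by (auto intro: indep_vars_subset)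
  \<comment> \<open>Independence of the pair is extracted from the family by treating
    \<open>X j\<close> as a sum over a singleton.\<close>
  then have "indep_var borel (X i) borel (\<lambda>\<omega>. \<Sum>k\<in>{j}. X k \<omega>)"
    using \<open>i \<noteq> j\<close> indep_vars_sum[of "{j}" i X] by simp
  then have ind: "indep_var borel (X i) borel (X j)" by simp
  show "integrable M (\<lambda>\<omega>. X i \<omega> * X j \<omega>)"
    "expectation (\<lambda>\<omega>. X i \<omega> * X j \<omega>) = expectation (X i) * expectation (X j)"
    using indep_var_integrable[OF ind] indep_var_lebesgue_integral[OF ind] assms by auto
qed

text \<open>Everything is expressed through the common law \<open>D\<close> of the terms, so that
  estimators with the same mean can later be compared by the second moments of a single term. The
  second moment of \<open>D\<close> is derived from that of the sample mean.\<close>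

lemma (in prob_space) iid_mean_moments:
  fixes X :: "nat \<Rightarrow> 'a \<Rightarrow> real" and D :: "real measure"
  assumes n: "n \<ge> 1" and ind: "indep_vars (\<lambda>_. borel) X {1..n}"
    and D: "\<And>i. i \<in> {1..n} \<Longrightarrow> distr M borel (X i) = D"
    and int: "integrable D (\<lambda>x. x)"
    and fin: "finite_mean_var M (\<lambda>\<omega>. 1 / real n * (\<Sum>i=1..n. X i \<omega>))"
  shows "expectation (\<lambda>\<omega>. 1 / real n * (\<Sum>i=1..n. X i \<omega>)) = (\<integral>x. x \<partial>D)"
    and "integrable D (\<lambda>x. x\<^sup>2)"
    and "variance (\<lambda>\<omega>. 1 / real n * (\<Sum>i=1..n. X i \<omega>)) = ((\<integral>x. x\<^sup>2 \<partial>D) - (\<integral>x. x \<partial>D)\<^sup>2) / real n"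
proof -
  let ?I = "{1..n}" and ?\<mu> = "\<integral>x. x \<partial>D" and ?q = "\<integral>x. x\<^sup>2 \<partial>D"
  let ?T = "\<lambda>\<omega>. 1 / real n * (\<Sum>i=1..n. X i \<omega>)"
  have rv [measurable]: "random_variable borel (X i)" if "i \<in> ?I" for i
    using ind that by (auto simp: indep_vars_def)
  have X1: "integrable M (X i)" "expectation (X i) = ?\<mu>" if "i \<in> ?I" for i
    using int rv[OF that] unfolding D[OF that, symmetric]
    by (auto simp: integrable_distr_eq integral_distr)
  \<comment> \<open>Multiplying by \<open>n^2\<close> undoes the normalization of the mean, which is
    possible because \<open>n\<close> is positive.\<close>
  have "integrable M (\<lambda>\<omega>. real n ^ 2 * (?T \<omega>)\<^sup>2)"
    using fin by (simp add: finite_mean_var_def)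
  then have sumsq: "integrable M (\<lambda>\<omega>. (\<Sum>i\<in>?I. X i \<omega>)\<^sup>2)"
    using n by (simp add: power_divide)
  have X2: "integrable M (\<lambda>\<omega>. (X i \<omega>)\<^sup>2)" if "i \<in> ?I" for i
    by (rule indep_vars_square_integrable[OF _ ind that sumsq]) simp
  have X2': "integrable D (\<lambda>x. x\<^sup>2)" "expectation (\<lambda>\<omega>. (X i \<omega>)\<^sup>2) = ?q" if "i \<in> ?I" for i
    using X2[OF that] rv[OF that] unfolding D[OF that, symmetric]
    by (auto simp: integrable_distr_eq integral_distr)
  show "integrable D (\<lambda>x. x\<^sup>2)"
    using X2'(1)[of 1] n by simp
  show mean: "expectation ?T = ?\<mu>"
    using n X1 by simp
  have mult: "integrable M (\<lambda>\<omega>. X i \<omega> * X j \<omega>)"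
      "expectation (\<lambda>\<omega>. X i \<omega> * X j \<omega>) = (if i = j then ?q else ?\<mu>\<^sup>2)"
    if ij: "i \<in> ?I" "j \<in> ?I" for i j
    using expectation_indep_mult[OF ind ij] X1 X2 X2'(2) ij
    by (cases "i = j"; simp add: power2_eq_square)+
  \<comment> \<open>A row of the matrix of mixed second moments has one diagonal entry and
    \<open>n - 1\<close> entries equal to the squared mean.\<close>
  have row: "(\<Sum>j\<in>?I. if i = j then ?q else ?\<mu>\<^sup>2) = ?q + (real n - 1) * ?\<mu>\<^sup>2" if "i \<in> ?I" for i
  proof -
    have "(\<Sum>j\<in>?I. if i = j then ?q else ?\<mu>\<^sup>2) = (\<Sum>j\<in>?I. ?\<mu>\<^sup>2 + (if i = j then ?q - ?\<mu>\<^sup>2 else 0))"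
      by (rule sum.cong) auto
    also have "\<dots> = real n * ?\<mu>\<^sup>2 + (?q - ?\<mu>\<^sup>2)"
      using that by (simp add: sum.distrib)
    finally show ?thesis by (simp add: algebra_simps)
  qed
  have "expectation (\<lambda>\<omega>. (\<Sum>i\<in>?I. X i \<omega>)\<^sup>2) = expectation (\<lambda>\<omega>. \<Sum>i\<in>?I. \<Sum>j\<in>?I. X i \<omega> * X j \<omega>)"
    by (simp add: power2_eq_square sum_product)
  also have "\<dots> = (\<Sum>i\<in>?I. expectation (\<lambda>\<omega>. \<Sum>j\<in>?I. X i \<omega> * X j \<omega>))"
    by (intro Bochner_Integration.integral_sum Bochner_Integration.integrable_sum mult)
  also have "\<dots> = (\<Sum>i\<in>?I. \<Sum>j\<in>?I. expectation (\<lambda>\<omega>. X i \<omega> * X j \<omega>))"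
    by (intro sum.cong refl Bochner_Integration.integral_sum mult)
  also have "\<dots> = (\<Sum>i\<in>?I. \<Sum>j\<in>?I. if i = j then ?q else ?\<mu>\<^sup>2)"
    by (intro sum.cong refl mult)
  also have "\<dots> = real n * (?q + (real n - 1) * ?\<mu>\<^sup>2)"
    using row by simp
  finally have S2: "expectation (\<lambda>\<omega>. (\<Sum>i\<in>?I. X i \<omega>)\<^sup>2) = real n * (?q + (real n - 1) * ?\<mu>\<^sup>2)" .
  have T2: "expectation (\<lambda>\<omega>. (?T \<omega>)\<^sup>2) = expectation (\<lambda>\<omega>. (\<Sum>i\<in>?I. X i \<omega>)\<^sup>2) / (real n)\<^sup>2"
    by (simp add: power_divide)
  have "variance ?T = expectation (\<lambda>\<omega>. (?T \<omega>)\<^sup>2) - (expectation ?T)\<^sup>2"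
    using fin by (intro variance_eq) (auto simp: finite_mean_var_def)
  also have "\<dots> = real n * (?q + (real n - 1) * ?\<mu>\<^sup>2) / (real n)\<^sup>2 - ?\<mu>\<^sup>2"
    by (simp only: T2 S2 mean)
  also have "\<dots> = (?q - ?\<mu>\<^sup>2) / real n"
    using n by (simp add: field_simps power2_eq_square)
  finally show "variance ?T = (?q - ?\<mu>\<^sup>2) / real n" .
qed

section \<open>Weighted moments\<close>

text \<open>Since \<open>ennreal\<close> sends negative numbers to 0, \<open>pos\<close> and
  \<open>neg\<close> are the change of law for the positive and the negative part of
  \<open>y\<close>. A nonnegative weight respects this splitting, so both integrability and the
  value of the integral carry over from \<open>Q\<close>.\<close>

lemma weighted_mean_transfer:
  fixes y w :: "'a \<Rightarrow> real"
  assumes [measurable]: "y \<in> borel_measurable P" "w \<in> borel_measurable P"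
    and w: "\<And>z. z \<in> space P \<Longrightarrow> 0 \<le> w z" and Q: "integrable Q y"
    and pos: "(\<integral>\<^sup>+z. ennreal (w z) * ennreal (y z) \<partial>P) = (\<integral>\<^sup>+z. ennreal (y z) \<partial>Q)"
    and neg: "(\<integral>\<^sup>+z. ennreal (w z) * ennreal (- y z) \<partial>P) = (\<integral>\<^sup>+z. ennreal (- y z) \<partial>Q)"
  shows "integrable P (\<lambda>z. w z * y z)" and "(\<integral>z. w z * y z \<partial>P) = (\<integral>z. y z \<partial>Q)"
proof -
  have p: "(\<integral>\<^sup>+z. ennreal (w z * y z) \<partial>P) = (\<integral>\<^sup>+z. ennreal (y z) \<partial>Q)"
    and n: "(\<integral>\<^sup>+z. ennreal (- (w z * y z)) \<partial>P) = (\<integral>\<^sup>+z. ennreal (- y z) \<partial>Q)"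
    unfolding pos[symmetric] neg[symmetric]
    using w by (auto intro!: nn_integral_cong simp: ennreal_mult'[symmetric])
  show *: "integrable P (\<lambda>z. w z * y z)"
    using Q by (simp add: real_integrable_def p n)
  show "(\<integral>z. w z * y z \<partial>P) = (\<integral>z. y z \<partial>Q)"
    by (simp add: real_lebesgue_integral_def[OF *] real_lebesgue_integral_def[OF Q] p n)
qed

text \<open>The hypothesis says that \<open>v\<close> is orthogonal to \<open>u - v\<close> in the weighted space, as it is when
  \<open>v\<close> is a conditional expectation of \<open>u\<close>.\<close>

lemma projected_weight_second_moment_le:
  fixes u v y :: "'a \<Rightarrow> real"
  assumes [measurable]: "u \<in> borel_measurable P" "v \<in> borel_measurable P" "y \<in> borel_measurable P"
    and nonneg: "\<And>z. z \<in> space P \<Longrightarrow> 0 \<le> u z" "\<And>z. z \<in> space P \<Longrightarrow> 0 \<le> v z"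
    and orth: "(\<integral>\<^sup>+z. ennreal (u z) * ennreal (v z * (y z)\<^sup>2) \<partial>P)
      = (\<integral>\<^sup>+z. ennreal (v z) * ennreal (v z * (y z)\<^sup>2) \<partial>P)"
    and u: "integrable P (\<lambda>z. (u z * y z)\<^sup>2)" and v: "integrable P (\<lambda>z. (v z * y z)\<^sup>2)"
  shows "(\<integral>z. (v z * y z)\<^sup>2 \<partial>P) \<le> (\<integral>z. (u z * y z)\<^sup>2 \<partial>P)"
proof -
  have eq: "(\<integral>\<^sup>+z. ennreal (u z * v z * (y z)\<^sup>2) \<partial>P) = (\<integral>\<^sup>+z. ennreal ((v z * y z)\<^sup>2) \<partial>P)"
  proof -
    have "(\<integral>\<^sup>+z. ennreal (u z * v z * (y z)\<^sup>2) \<partial>P) = (\<integral>\<^sup>+z. ennreal (u z) * ennreal (v z * (y z)\<^sup>2) \<partial>P)"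
      using nonneg by (intro nn_integral_cong) (simp add: ennreal_mult'[symmetric] mult.assoc)
    also have "\<dots> = (\<integral>\<^sup>+z. ennreal (v z) * ennreal (v z * (y z)\<^sup>2) \<partial>P)"
      by (rule orth)
    also have "\<dots> = (\<integral>\<^sup>+z. ennreal ((v z * y z)\<^sup>2) \<partial>P)"
      using nonneg by (intro nn_integral_cong)
        (simp add: ennreal_mult'[symmetric] power_mult_distrib power2_eq_square mult_ac)
    finally show ?thesis .
  qed
  have ae: "AE z in P. 0 \<le> u z * v z * (y z)\<^sup>2"
    using nonneg by (intro AE_I2) simp
  \<comment> \<open>By \<open>eq\<close> the integral of the cross term is the second moment of
    \<open>v * y\<close>, which is finite by \<open>v\<close>.\<close>
  have uv: "integrable P (\<lambda>z. u z * v z * (y z)\<^sup>2)"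
    using v by (intro integrableI_nonneg ae) (simp_all add: eq integrable_iff_bounded)
  have "(\<integral>z. u z * v z * (y z)\<^sup>2 \<partial>P) = (\<integral>z. (v z * y z)\<^sup>2 \<partial>P)"
    by (simp add: integral_eq_nn_integral ae eq)
  \<comment> \<open>The left side is twice the second moment of \<open>v * y\<close>, so cancelling
    one copy of it gives the claim.\<close>
  moreover have "(\<integral>z. 2 * (u z * v z * (y z)\<^sup>2) \<partial>P) \<le> (\<integral>z. (u z * y z)\<^sup>2 + (v z * y z)\<^sup>2 \<partial>P)"
  proof (rule integral_mono)
    show "2 * (u z * v z * (y z)\<^sup>2) \<le> (u z * y z)\<^sup>2 + (v z * y z)\<^sup>2" for z
      using zero_le_power2[of "u z * y z - v z * y z"] by (simp add: power2_eq_square algebra_simps)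
  qed (use u v uv in auto)
  ultimately show ?thesis using u v by simp
qed

text \<open>Finite total mass makes both densities finite almost everywhere, so
  \<open>enn2real\<close> loses nothing there. Where \<open>mb\<close> is positive the ratio cancels
  it; where \<open>mb\<close> vanishes, so does \<open>mt\<close>, and both integrands are
  0.\<close>

lemma nn_integral_ratio_weight:
  fixes mt mb :: "'v \<Rightarrow> ennreal" and k :: "'v \<Rightarrow> ennreal"
  assumes [measurable]: "mt \<in> borel_measurable N" "mb \<in> borel_measurable N"
    and fin: "(\<integral>\<^sup>+v. mt v \<partial>N) < \<infinity>" "(\<integral>\<^sup>+v. mb v \<partial>N) < \<infinity>"
    and zero: "\<And>v. v \<in> space N \<Longrightarrow> mb v = 0 \<Longrightarrow> mt v = 0"
  shows "(\<integral>\<^sup>+v. mb v * (ennreal (enn2real (mt v) / enn2real (mb v)) * k v) \<partial>N)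
    = (\<integral>\<^sup>+v. mt v * k v \<partial>N)"
proof (rule nn_integral_cong_AE)
  have "AE v in N. mt v \<noteq> \<infinity>" "AE v in N. mb v \<noteq> \<infinity>"
    by (rule nn_integral_noteq_infinite; use fin in \<open>simp add: less_top\<close>)+
  then show "AE v in N. mb v * (ennreal (enn2real (mt v) / enn2real (mb v)) * k v) = mt v * k v"
    using AE_space
  proof eventually_elim
    case (elim v)
    show ?case
    proof (cases "mb v = 0")
      case True
      then show ?thesis using zero elim by simp
    next
      case False
      then obtain b where b: "mb v = ennreal b" "b > 0"
        using elim by (cases "mb v") (auto simp: ennreal_eq_0_iff order_less_le)
      obtain t where t: "mt v = ennreal t" "t \<ge> 0"
        using elim by (cases "mt v") auto
      have "mb v * ennreal (enn2real (mt v) / enn2real (mb v)) = mt v"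
        using b t by (simp add: ennreal_mult'[symmetric])
      then show ?thesis by (simp add: mult.assoc[symmetric])
    qed
  qed
qed

text \<open>The reference measures are products nested to the right, while the chain below treats
  context and action as one variable. This regrouping mediates between the two.\<close>

lemma nn_integral_pair_assoc:
  assumes B: "sigma_finite_measure B" and C: "sigma_finite_measure C"
    and [measurable]: "F \<in> borel_measurable (A \<Otimes>\<^sub>M B \<Otimes>\<^sub>M C)"
  shows "(\<integral>\<^sup>+z. F z \<partial>(A \<Otimes>\<^sub>M B \<Otimes>\<^sub>M C))
    = (\<integral>\<^sup>+u. \<integral>\<^sup>+z. F (fst u, snd u, z) \<partial>C \<partial>(A \<Otimes>\<^sub>M B))"
proof -
  interpret B: sigma_finite_measure B by fact
  interpret C: sigma_finite_measure C by fact
  interpret BC: sigma_finite_measure "B \<Otimes>\<^sub>M C"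
    using B C by (rule sigma_finite_pair_measure)
  have "(\<integral>\<^sup>+z. F z \<partial>(A \<Otimes>\<^sub>M B \<Otimes>\<^sub>M C)) = (\<integral>\<^sup>+x. \<integral>\<^sup>+q. F (x, q) \<partial>(B \<Otimes>\<^sub>M C) \<partial>A)"
    by (rule BC.nn_integral_fst[symmetric]) measurable
  also have "\<dots> = (\<integral>\<^sup>+x. \<integral>\<^sup>+a. \<integral>\<^sup>+z. F (x, a, z) \<partial>C \<partial>B \<partial>A)"
    by (intro nn_integral_cong C.nn_integral_fst[symmetric]) measurable
  also have "\<dots> = (\<integral>\<^sup>+u. \<integral>\<^sup>+z. F (fst u, snd u, z) \<partial>C \<partial>(A \<Otimes>\<^sub>M B))"
    by (subst B.nn_integral_fst[symmetric]) simp_all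
  finally show ?thesis .
qed

lemma nn_integral_swap:
  assumes "sigma_finite_measure A" "sigma_finite_measure B"
    and F: "case_prod F \<in> borel_measurable (A \<Otimes>\<^sub>M B)"
  shows "(\<integral>\<^sup>+x. \<integral>\<^sup>+y. F x y \<partial>B \<partial>A) = (\<integral>\<^sup>+y. \<integral>\<^sup>+x. F x y \<partial>A \<partial>B)"
  using pair_sigma_finite.Fubini'[OF pair_sigma_finite.intro, OF assms] by simp

section \<open>Marginal density ratios along a Markov chain\<close>

text \<open>\<open>U\<close> is the space of context-action pairs. The policy enters only through their density \<open>h\<close>,
  which is therefore an argument below; the kernels \<open>e\<close>, \<open>f\<close>, \<open>g\<close> are shared by all policies.\<close>

locale embedding_chain =
  U: sigma_finite_measure U + R: sigma_finite_measure R +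
  S: sigma_finite_measure S + Y: sigma_finite_measure Y
  for U :: "'u measure" and R :: "'r measure" and S :: "'s measure" and Y :: "'y measure" +
  fixes e :: "'u \<Rightarrow> 'r \<Rightarrow> ennreal" and f :: "'r \<Rightarrow> 's \<Rightarrow> ennreal" and g :: "'s \<Rightarrow> 'y \<Rightarrow> ennreal"
  assumes e_meas [measurable]: "case_prod e \<in> borel_measurable (U \<Otimes>\<^sub>M R)"
    and f_meas [measurable]: "case_prod f \<in> borel_measurable (R \<Otimes>\<^sub>M S)"
    and g_meas [measurable]: "case_prod g \<in> borel_measurable (S \<Otimes>\<^sub>M Y)"
    and e_total: "u \<in> space U \<Longrightarrow> (\<integral>\<^sup>+r. e u r \<partial>R) = 1"
    and f_total: "r \<in> space R \<Longrightarrow> (\<integral>\<^sup>+s. f r s \<partial>S) = 1"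
    and g_total: "s \<in> space S \<Longrightarrow> (\<integral>\<^sup>+y. g s y \<partial>Y) = 1"
begin


text \<open>With \<open>h\<close> the density of the context-action pair, this is the integral of
  \<open>\<phi>\<close> against the joint law. The iterated form lets kernels of total mass one be
  integrated out one after the other, starting with the innermost.\<close>

definition chain_integral :: "('u \<Rightarrow> ennreal) \<Rightarrow> ('u \<times> 'r \<times> 's \<times> 'y \<Rightarrow> ennreal) \<Rightarrow> ennreal" where
  "chain_integral h \<phi> =
     (\<integral>\<^sup>+u. \<integral>\<^sup>+r. \<integral>\<^sup>+s. \<integral>\<^sup>+y. h u * e u r * f r s * g s y * \<phi> (u, r, s, y) \<partial>Y \<partial>S \<partial>R \<partial>U)"

definition marg1 :: "('u \<Rightarrow> ennreal) \<Rightarrow> 'r \<Rightarrow> ennreal" where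
  "marg1 h r = (\<integral>\<^sup>+u. \<integral>\<^sup>+s. \<integral>\<^sup>+y. h u * e u r * f r s * g s y \<partial>Y \<partial>S \<partial>U)"

definition marg2 :: "('u \<Rightarrow> ennreal) \<Rightarrow> 's \<Rightarrow> ennreal" where
  "marg2 h s = (\<integral>\<^sup>+u. \<integral>\<^sup>+r. \<integral>\<^sup>+y. h u * e u r * f r s * g s y \<partial>Y \<partial>R \<partial>U)"

definition marg3 :: "('u \<Rightarrow> ennreal) \<Rightarrow> 'y \<Rightarrow> ennreal" where
  "marg3 h y = (\<integral>\<^sup>+u. \<integral>\<^sup>+r. \<integral>\<^sup>+s. h u * e u r * f r s * g s y \<partial>S \<partial>R \<partial>U)"

section \<open>Reduction of chain integrals to marginals\<close>

lemma measurable_marg1 [measurable]: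
  assumes [measurable]: "h \<in> borel_measurable U"
  shows "marg1 h \<in> borel_measurable R"
  unfolding marg1_def[abs_def] by measurable

lemma measurable_marg2 [measurable]:
  assumes [measurable]: "h \<in> borel_measurable U"
  shows "marg2 h \<in> borel_measurable S"
  unfolding marg2_def[abs_def] by measurable

lemma measurable_marg3 [measurable]:
  assumes [measurable]: "h \<in> borel_measurable U"
  shows "marg3 h \<in> borel_measurable Y"
  unfolding marg3_def[abs_def] by measurable

text \<open>The integral over the later variables is a function \<open>K\<close> of \<open>r\<close>
  alone, in which \<open>h\<close> does not occur. Exchanging \<open>u\<close> and \<open>r\<close>
  then collects everything that depends on \<open>h\<close> in the marginal.\<close>

lemma chain_integral_marg1:
  assumes [measurable]: "h \<in> borel_measurable U" "\<phi> \<in> borel_measurable (R \<Otimes>\<^sub>M S \<Otimes>\<^sub>M Y)"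
  shows "chain_integral h (\<lambda>(u, q). \<phi> q)
    = (\<integral>\<^sup>+r. marg1 h r * (\<integral>\<^sup>+s. \<integral>\<^sup>+y. f r s * g s y * \<phi> (r, s, y) \<partial>Y \<partial>S) \<partial>R)"
proof -
  define K where "K r = (\<integral>\<^sup>+s. \<integral>\<^sup>+y. f r s * g s y * \<phi> (r, s, y) \<partial>Y \<partial>S)" for r
  have [measurable]: "K \<in> borel_measurable R" unfolding K_def[abs_def] by measurable
  \<comment> \<open>The kernels \<open>g\<close> and \<open>f\<close> have total mass one and drop
    out of the marginal, in this order.\<close>
  have m: "marg1 h r = (\<integral>\<^sup>+u. h u * e u r \<partial>U)" if [measurable]: "r \<in> space R" for r
  proof -
    have "(\<integral>\<^sup>+s. \<integral>\<^sup>+y. h u * e u r * f r s * g s y \<partial>Y \<partial>S) = h u * e u r" if "u \<in> space U" for u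
    proof -
      have "(\<integral>\<^sup>+s. \<integral>\<^sup>+y. h u * e u r * f r s * g s y \<partial>Y \<partial>S)
        = (\<integral>\<^sup>+s. h u * e u r * f r s \<partial>S)"
        by (intro nn_integral_cong) (simp add: nn_integral_cmult g_total)
      then show ?thesis by (simp add: nn_integral_cmult f_total \<open>r \<in> space R\<close>)
    qed
    then show ?thesis unfolding marg1_def by (intro nn_integral_cong) simp
  qed
  have "chain_integral h (\<lambda>(u, q). \<phi> q) = (\<integral>\<^sup>+u. \<integral>\<^sup>+r. h u * e u r * K r \<partial>R \<partial>U)"
    unfolding chain_integral_def
  proof (intro nn_integral_cong)
    fix u r assume [measurable]: "u \<in> space U" "r \<in> space R"
    have "(\<integral>\<^sup>+s. \<integral>\<^sup>+y. h u * e u r * f r s * g s y * (case (u, r, s, y) of (u, q) \<Rightarrow> \<phi> q) \<partial>Y \<partial>S)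
      = (\<integral>\<^sup>+s. \<integral>\<^sup>+y. (h u * e u r) * (f r s * g s y * \<phi> (r, s, y)) \<partial>Y \<partial>S)"
      by (simp add: mult.assoc)
    also have "\<dots> = (\<integral>\<^sup>+s. (h u * e u r) * (\<integral>\<^sup>+y. f r s * g s y * \<phi> (r, s, y) \<partial>Y) \<partial>S)"
      by (intro nn_integral_cong nn_integral_cmult) measurable
    also have "\<dots> = h u * e u r * K r"
      unfolding K_def by (rule nn_integral_cmult) measurable
    finally show "(\<integral>\<^sup>+s. \<integral>\<^sup>+y. h u * e u r * f r s * g s y * (case (u, r, s, y) of (u, q) \<Rightarrow> \<phi> q) \<partial>Y \<partial>S)
      = h u * e u r * K r" .
  qed
  also have "\<dots> = (\<integral>\<^sup>+r. \<integral>\<^sup>+u. h u * e u r * K r \<partial>U \<partial>R)"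
    by (rule nn_integral_swap[OF U.sigma_finite_measure_axioms R.sigma_finite_measure_axioms]) measurable
  also have "\<dots> = (\<integral>\<^sup>+r. marg1 h r * K r \<partial>R)"
    by (intro nn_integral_cong) (simp add: m nn_integral_multc)
  finally show ?thesis unfolding K_def .
qed

text \<open>As before, with \<open>s\<close> moved outwards past \<open>r\<close> and then past
  \<open>u\<close>; only \<open>g\<close> drops out of the marginal.\<close>

lemma chain_integral_marg2:
  assumes [measurable]: "h \<in> borel_measurable U" "\<phi> \<in> borel_measurable (S \<Otimes>\<^sub>M Y)"
  shows "chain_integral h (\<lambda>(u, r, q). \<phi> q)
    = (\<integral>\<^sup>+s. marg2 h s * (\<integral>\<^sup>+y. g s y * \<phi> (s, y) \<partial>Y) \<partial>S)"
proof -
  define K where "K s = (\<integral>\<^sup>+y. g s y * \<phi> (s, y) \<partial>Y)" for s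
  have [measurable]: "K \<in> borel_measurable S" unfolding K_def[abs_def] by measurable
  have m: "marg2 h s = (\<integral>\<^sup>+u. \<integral>\<^sup>+r. h u * e u r * f r s \<partial>R \<partial>U)" if [measurable]: "s \<in> space S" for s
    unfolding marg2_def
    by (intro nn_integral_cong) (simp add: nn_integral_cmult g_total \<open>s \<in> space S\<close>)
  have "chain_integral h (\<lambda>(u, r, q). \<phi> q) = (\<integral>\<^sup>+u. \<integral>\<^sup>+r. \<integral>\<^sup>+s. h u * e u r * f r s * K s \<partial>S \<partial>R \<partial>U)"
    unfolding chain_integral_def
  proof (intro nn_integral_cong)
    fix u r s assume [measurable]: "u \<in> space U" "r \<in> space R" "s \<in> space S"
    have "(\<integral>\<^sup>+y. h u * e u r * f r s * g s y * (case (u, r, s, y) of (u, r, q) \<Rightarrow> \<phi> q) \<partial>Y)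
      = (\<integral>\<^sup>+y. (h u * e u r * f r s) * (g s y * \<phi> (s, y)) \<partial>Y)"
      by (simp add: mult.assoc)
    also have "\<dots> = h u * e u r * f r s * K s"
      unfolding K_def by (rule nn_integral_cmult) measurable
    finally show "(\<integral>\<^sup>+y. h u * e u r * f r s * g s y * (case (u, r, s, y) of (u, r, q) \<Rightarrow> \<phi> q) \<partial>Y)
      = h u * e u r * f r s * K s" .
  qed
  also have "\<dots> = (\<integral>\<^sup>+u. \<integral>\<^sup>+s. \<integral>\<^sup>+r. h u * e u r * f r s * K s \<partial>R \<partial>S \<partial>U)"
    by (intro nn_integral_cong nn_integral_swap[OF R.sigma_finite_measure_axioms S.sigma_finite_measure_axioms]) measurable
  also have "\<dots> = (\<integral>\<^sup>+s. \<integral>\<^sup>+u. \<integral>\<^sup>+r. h u * e u r * f r s * K s \<partial>R \<partial>U \<partial>S)"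
    by (rule nn_integral_swap[OF U.sigma_finite_measure_axioms S.sigma_finite_measure_axioms]) measurable
  also have "\<dots> = (\<integral>\<^sup>+s. marg2 h s * K s \<partial>S)"
    by (intro nn_integral_cong) (simp add: m nn_integral_multc cong: nn_integral_cong)
  finally show ?thesis unfolding K_def .
qed

text \<open>No kernel follows \<open>y\<close>, so it suffices to move \<open>y\<close> outwards
  past \<open>s\<close>, \<open>r\<close> and \<open>u\<close>.\<close>

lemma chain_integral_marg3:
  assumes [measurable]: "h \<in> borel_measurable U" "\<phi> \<in> borel_measurable Y"
  shows "chain_integral h (\<lambda>(u, r, s, y). \<phi> y) = (\<integral>\<^sup>+y. marg3 h y * \<phi> y \<partial>Y)"
proof -
  have "chain_integral h (\<lambda>(u, r, s, y). \<phi> y)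
      = (\<integral>\<^sup>+u. \<integral>\<^sup>+r. \<integral>\<^sup>+y. \<integral>\<^sup>+s. h u * e u r * f r s * g s y * \<phi> y \<partial>S \<partial>Y \<partial>R \<partial>U)"
    unfolding chain_integral_def prod.case
    by (intro nn_integral_cong nn_integral_swap[OF S.sigma_finite_measure_axioms Y.sigma_finite_measure_axioms]) measurable
  also have "\<dots> = (\<integral>\<^sup>+u. \<integral>\<^sup>+y. \<integral>\<^sup>+r. \<integral>\<^sup>+s. h u * e u r * f r s * g s y * \<phi> y \<partial>S \<partial>R \<partial>Y \<partial>U)"
    by (intro nn_integral_cong nn_integral_swap[OF R.sigma_finite_measure_axioms Y.sigma_finite_measure_axioms]) measurable
  also have "\<dots> = (\<integral>\<^sup>+y. \<integral>\<^sup>+u. \<integral>\<^sup>+r. \<integral>\<^sup>+s. h u * e u r * f r s * g s y * \<phi> y \<partial>S \<partial>R \<partial>U \<partial>Y)"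
    by (rule nn_integral_swap[OF U.sigma_finite_measure_axioms Y.sigma_finite_measure_axioms]) measurable
  also have "\<dots> = (\<integral>\<^sup>+y. marg3 h y * \<phi> y \<partial>Y)"
    unfolding marg3_def by (intro nn_integral_cong) (simp add: nn_integral_multc cong: nn_integral_cong)
  finally show ?thesis .
qed

text \<open>This supplies the condition on zeros in \<open>nn_integral_ratio_weight\<close>:
  inclusion of supports passes from the context-action densities to every marginal, at each point of
  the space.\<close>

lemma marg_eq_0_mono:
  assumes [measurable]: "h \<in> borel_measurable U" 
    and zero: "\<And>u. u \<in> space U \<Longrightarrow> h u = 0 \<Longrightarrow> h' u = 0"
  shows "r \<in> space R \<Longrightarrow> marg1 h r = 0 \<Longrightarrow> marg1 h' r = 0"
    and "s \<in> space S \<Longrightarrow> marg2 h s = 0 \<Longrightarrow> marg2 h' s = 0"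
    and "y \<in> space Y \<Longrightarrow> marg3 h y = 0 \<Longrightarrow> marg3 h' y = 0"
proof -
  \<comment> \<open>In the extended reals, inclusion of supports is the domination \<open>h' \<le> \<infinity> * h\<close>, which integrates.\<close>
  have le: "h' u * a * b * c \<le> top * (h u * a * b * c)" if "u \<in> space U" for u a b c
  proof -
    have "h' u \<le> top * h u" using zero[OF that] by (cases "h u = 0") (auto simp: ennreal_top_mult)
    then have "h' u * (a * b * c) \<le> (top * h u) * (a * b * c)" by (rule mult_right_mono) simp
    then show ?thesis by (simp add: mult.assoc)
  qed
  show "marg1 h' r = 0" if [measurable]: "r \<in> space R" and "marg1 h r = 0"
  proof -
    have "marg1 h' r \<le> (\<integral>\<^sup>+u. \<integral>\<^sup>+s. \<integral>\<^sup>+y. top * (h u * e u r * f r s * g s y) \<partial>Y \<partial>S \<partial>U)"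
      unfolding marg1_def by (intro nn_integral_mono le)
    also have "\<dots> = top * marg1 h r"
      unfolding marg1_def by (simp add: nn_integral_cmult cong: nn_integral_cong)
    \<comment> \<open>The bound is useful because \<open>top * 0 = 0\<close> in
      \<open>ennreal\<close>.\<close>
    finally show ?thesis using that by simp
  qed
  show "marg2 h' s = 0" if [measurable]: "s \<in> space S" and "marg2 h s = 0"
  proof -
    have "marg2 h' s \<le> (\<integral>\<^sup>+u. \<integral>\<^sup>+r. \<integral>\<^sup>+y. top * (h u * e u r * f r s * g s y) \<partial>Y \<partial>R \<partial>U)"
      unfolding marg2_def by (intro nn_integral_mono le)
    also have "\<dots> = top * marg2 h s"
      unfolding marg2_def by (simp add: nn_integral_cmult cong: nn_integral_cong)
    finally show ?thesis using that by simp
  qed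
  show "marg3 h' y = 0" if [measurable]: "y \<in> space Y" and "marg3 h y = 0"
  proof -
    have "marg3 h' y \<le> (\<integral>\<^sup>+u. \<integral>\<^sup>+r. \<integral>\<^sup>+s. top * (h u * e u r * f r s * g s y) \<partial>S \<partial>R \<partial>U)"
      unfolding marg3_def by (intro nn_integral_mono le)
    also have "\<dots> = top * marg3 h y"
      unfolding marg3_def by (simp add: nn_integral_cmult cong: nn_integral_cong)
    finally show ?thesis using that by simp
  qed
qed

lemma chain_integral_one:
  assumes [measurable]: "h \<in> borel_measurable U"
  shows "chain_integral h (\<lambda>_. 1) = (\<integral>\<^sup>+u. h u \<partial>U)"
proof -
  have "chain_integral h (\<lambda>_. 1) = (\<integral>\<^sup>+u. \<integral>\<^sup>+r. \<integral>\<^sup>+s. h u * e u r * f r s \<partial>S \<partial>R \<partial>U)"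
    unfolding chain_integral_def
    by (intro nn_integral_cong) (simp add: nn_integral_cmult g_total)
  also have "\<dots> = (\<integral>\<^sup>+u. \<integral>\<^sup>+r. h u * e u r \<partial>R \<partial>U)"
    by (intro nn_integral_cong) (simp add: nn_integral_cmult f_total)
  also have "\<dots> = (\<integral>\<^sup>+u. h u \<partial>U)"
    by (intro nn_integral_cong) (simp add: nn_integral_cmult e_total)
  finally show ?thesis .
qed

text \<open>The test function 1 in the reductions to marginals shows that every marginal has the
  mass of \<open>h\<close>. This yields the finiteness that \<open>nn_integral_ratio_weight\<close>
  asks for.\<close>

lemma nn_integral_marg:
  assumes [measurable]: "h \<in> borel_measurable U"
  shows "(\<integral>\<^sup>+r. marg1 h r \<partial>R) = (\<integral>\<^sup>+u. h u \<partial>U)"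
    and "(\<integral>\<^sup>+s. marg2 h s \<partial>S) = (\<integral>\<^sup>+u. h u \<partial>U)"
    and "(\<integral>\<^sup>+y. marg3 h y \<partial>Y) = (\<integral>\<^sup>+u. h u \<partial>U)"
proof -
  have fg: "(\<integral>\<^sup>+s. \<integral>\<^sup>+y. f r s * g s y \<partial>Y \<partial>S) = 1" if [measurable]: "r \<in> space R" for r
  proof -
    have "(\<integral>\<^sup>+s. \<integral>\<^sup>+y. f r s * g s y \<partial>Y \<partial>S) = (\<integral>\<^sup>+s. f r s \<partial>S)"
      by (intro nn_integral_cong) (simp add: nn_integral_cmult g_total)
    then show ?thesis by (simp add: f_total that)
  qed
  have "(\<integral>\<^sup>+r. marg1 h r \<partial>R)
      = (\<integral>\<^sup>+r. marg1 h r * (\<integral>\<^sup>+s. \<integral>\<^sup>+y. f r s * g s y * 1 \<partial>Y \<partial>S) \<partial>R)"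
    by (intro nn_integral_cong) (simp add: fg)
  then show "(\<integral>\<^sup>+r. marg1 h r \<partial>R) = (\<integral>\<^sup>+u. h u \<partial>U)"
    using chain_integral_marg1[of h "\<lambda>_. 1"] chain_integral_one[of h] by (simp add: case_prod_unfold)
  have "(\<integral>\<^sup>+s. marg2 h s \<partial>S) = (\<integral>\<^sup>+s. marg2 h s * (\<integral>\<^sup>+y. g s y * 1 \<partial>Y) \<partial>S)"
    by (intro nn_integral_cong) (simp add: g_total)
  then show "(\<integral>\<^sup>+s. marg2 h s \<partial>S) = (\<integral>\<^sup>+u. h u \<partial>U)"
    using chain_integral_marg2[of h "\<lambda>_. 1"] chain_integral_one[of h] by (simp add: case_prod_unfold)
  show "(\<integral>\<^sup>+y. marg3 h y \<partial>Y) = (\<integral>\<^sup>+u. h u \<partial>U)"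
    using chain_integral_marg3[of h "\<lambda>_. 1"] chain_integral_one[of h] by (simp add: case_prod_unfold)
qed

section \<open>Change from the behaviour density \<open>hb\<close> to the target density
  \<open>ht\<close>\<close>

context
  fixes ht hb :: "'u \<Rightarrow> ennreal"
  assumes ht [measurable]: "ht \<in> borel_measurable U" and hb [measurable]: "hb \<in> borel_measurable U"
    and fin: "(\<integral>\<^sup>+u. ht u \<partial>U) < \<infinity>" "(\<integral>\<^sup>+u. hb u \<partial>U) < \<infinity>"
    and supp: "\<And>u. u \<in> space U \<Longrightarrow> hb u = 0 \<Longrightarrow> ht u = 0"
begin

lemma marg_support:
  shows "r \<in> space R \<Longrightarrow> marg1 hb r = 0 \<Longrightarrow> marg1 ht r = 0"
    and "s \<in> space S \<Longrightarrow> marg2 hb s = 0 \<Longrightarrow> marg2 ht s = 0"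
    and "y \<in> space Y \<Longrightarrow> marg3 hb y = 0 \<Longrightarrow> marg3 ht y = 0"
  using marg_eq_0_mono[of hb ht] hb supp by blast+

text \<open>The law of \<open>(s, y)\<close> given \<open>r\<close> is the same for both densities.
  Reduced to an integral over \<open>r\<close>, the statement is therefore the cancellation of
  \<open>marg1 hb\<close> against the denominator of the weight.\<close>

lemma chain_integral_weight1:
  assumes [measurable]: "\<phi> \<in> borel_measurable (R \<Otimes>\<^sub>M S \<Otimes>\<^sub>M Y)"
  shows "chain_integral hb
      (\<lambda>(u, r, q). ennreal (enn2real (marg1 ht r) / enn2real (marg1 hb r)) * \<phi> (r, q))
    = chain_integral ht (\<lambda>(u, q). \<phi> q)"
proof -
  let ?w = "\<lambda>r. ennreal (enn2real (marg1 ht r) / enn2real (marg1 hb r))"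
  have "chain_integral hb (\<lambda>(u, r, q). ?w r * \<phi> (r, q))
      = chain_integral hb (\<lambda>(u, q). ?w (fst q) * \<phi> q)"
    by (simp add: case_prod_unfold)
  also have "\<dots> = (\<integral>\<^sup>+r. marg1 hb r *
      (\<integral>\<^sup>+s. \<integral>\<^sup>+y. f r s * g s y * (?w r * \<phi> (r, s, y)) \<partial>Y \<partial>S) \<partial>R)"
    by (subst chain_integral_marg1) simp_all
  \<comment> \<open>The instance of \<open>mult.left_commute\<close> brings the weight to the front
    of the integrand, where it is constant in \<open>s\<close> and \<open>y\<close> and can be
    pulled out.\<close>
  also have "\<dots> = (\<integral>\<^sup>+r. marg1 hb r *
      (?w r * (\<integral>\<^sup>+s. \<integral>\<^sup>+y. f r s * g s y * \<phi> (r, s, y) \<partial>Y \<partial>S)) \<partial>R)"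
    by (intro nn_integral_cong)
       (simp add: mult.left_commute[of _ "?w _"] nn_integral_cmult cong: nn_integral_cong)
  also have "\<dots> = chain_integral ht (\<lambda>(u, q). \<phi> q)"
    by (subst chain_integral_marg1, measurable, rule nn_integral_ratio_weight)
       (simp_all add: nn_integral_marg marg_support fin[simplified])
  finally show ?thesis .
qed

lemma chain_integral_weight2:
  assumes [measurable]: "\<phi> \<in> borel_measurable (S \<Otimes>\<^sub>M Y)"
  shows "chain_integral hb
      (\<lambda>(u, r, s, y). ennreal (enn2real (marg2 ht s) / enn2real (marg2 hb s)) * \<phi> (s, y))
    = chain_integral ht (\<lambda>(u, r, q). \<phi> q)"
proof -
  let ?w = "\<lambda>s. ennreal (enn2real (marg2 ht s) / enn2real (marg2 hb s))"
  have "chain_integral hb (\<lambda>(u, r, s, y). ?w s * \<phi> (s, y))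
      = chain_integral hb (\<lambda>(u, r, q). ?w (fst q) * \<phi> q)"
    by (simp add: case_prod_unfold)
  also have "\<dots> = (\<integral>\<^sup>+s. marg2 hb s * (\<integral>\<^sup>+y. g s y * (?w s * \<phi> (s, y)) \<partial>Y) \<partial>S)"
    by (subst chain_integral_marg2) simp_all
  also have "\<dots> = (\<integral>\<^sup>+s. marg2 hb s * (?w s * (\<integral>\<^sup>+y. g s y * \<phi> (s, y) \<partial>Y)) \<partial>S)"
    by (intro nn_integral_cong)
       (simp add: mult.left_commute[of _ "?w _"] nn_integral_cmult cong: nn_integral_cong)
  also have "\<dots> = chain_integral ht (\<lambda>(u, r, q). \<phi> q)"
    by (subst chain_integral_marg2, measurable, rule nn_integral_ratio_weight)
       (simp_all add: nn_integral_marg marg_support fin[simplified])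
  finally show ?thesis .
qed

lemma chain_integral_weight3:
  assumes [measurable]: "\<phi> \<in> borel_measurable Y"
  shows "chain_integral hb
      (\<lambda>(u, r, s, y). ennreal (enn2real (marg3 ht y) / enn2real (marg3 hb y)) * \<phi> y)
    = chain_integral ht (\<lambda>(u, r, s, y). \<phi> y)"
  by (subst (1 2) chain_integral_marg3, measurable, rule nn_integral_ratio_weight)
     (simp_all add: nn_integral_marg marg_support fin[simplified])

end

end

section \<open>The bandit model\<close>

locale bandit_model =
  fixes B :: "('x, 'a, 'r, 's) bandit"
  assumes wf: "wf_bandit B"
begin

abbreviation "C \<equiv> ctx_ref B"
abbreviation "A \<equiv> act_ref B"
abbreviation "U \<equiv> ctx_ref B \<Otimes>\<^sub>M act_ref B"
abbreviation "R \<equiv> emb1_ref B"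
abbreviation "S \<equiv> emb2_ref B"
abbreviation "Y \<equiv> out_ref B"

definition emb1_kernel :: "'x \<times> 'a \<Rightarrow> 'r \<Rightarrow> ennreal" where
  "emb1_kernel u r = ennreal (emb1_dens B (fst u) (snd u) r)"

definition emb2_kernel :: "'r \<Rightarrow> 's \<Rightarrow> ennreal" where
  "emb2_kernel r s = ennreal (emb2_dens B r s)"

definition out_kernel :: "'s \<Rightarrow> real \<Rightarrow> ennreal" where
  "out_kernel s y = ennreal (out_dens B s y)"

definition ctx_act_dens :: "('x \<Rightarrow> 'a \<Rightarrow> real) \<Rightarrow> 'x \<times> 'a \<Rightarrow> ennreal" where
  "ctx_act_dens \<pi> u = ennreal (ctx_dens B (fst u) * \<pi> (fst u) (snd u))"

section \<open>The bandit as an instance of the chain\<close>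

lemma refs_sigma_finite:
  "sigma_finite_measure C" "sigma_finite_measure A" "sigma_finite_measure R"
  "sigma_finite_measure S" "sigma_finite_measure Y"
  using wf by (auto simp: wf_bandit_def)

sublocale embedding_chain U R S Y emb1_kernel emb2_kernel out_kernel
proof (intro embedding_chain.intro embedding_chain_axioms.intro)
  show "sigma_finite_measure U"
    by (intro sigma_finite_pair_measure refs_sigma_finite)
  have k: "cond_density U R (\<lambda>(x, a). emb1_dens B x a)" "cond_density R S (emb2_dens B)"
      "cond_density S Y (out_dens B)"
    using wf by (auto simp: wf_bandit_def)
  then have [measurable]:
    "(\<lambda>z. emb1_dens B (fst (fst z)) (snd (fst z)) (snd z)) \<in> borel_measurable (U \<Otimes>\<^sub>M R)"
    "(\<lambda>z. emb2_dens B (fst z) (snd z)) \<in> borel_measurable (R \<Otimes>\<^sub>M S)"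
    "(\<lambda>z. out_dens B (fst z) (snd z)) \<in> borel_measurable (S \<Otimes>\<^sub>M Y)"
    by (simp_all add: cond_density_def case_prod_unfold)
  show "case_prod emb1_kernel \<in> borel_measurable (U \<Otimes>\<^sub>M R)"
    "case_prod emb2_kernel \<in> borel_measurable (R \<Otimes>\<^sub>M S)"
    "case_prod out_kernel \<in> borel_measurable (S \<Otimes>\<^sub>M Y)"
    unfolding case_prod_unfold emb1_kernel_def emb2_kernel_def out_kernel_def by measurable
  show "(\<integral>\<^sup>+r. emb1_kernel u r \<partial>R) = 1" if "u \<in> space U" for u
    using k(1) that by (auto simp: cond_density_def emb1_kernel_def case_prod_unfold)
  show "(\<integral>\<^sup>+s. emb2_kernel r s \<partial>S) = 1" if "r \<in> space R" for r
    using k(2) that by (auto simp: cond_density_def emb2_kernel_def)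
  show "(\<integral>\<^sup>+y. out_kernel s y \<partial>Y) = 1" if "s \<in> space S" for s
    using k(3) that by (auto simp: cond_density_def out_kernel_def)
qed (rule refs_sigma_finite)+

lemma measurable_ctx_act_dens [measurable]:
  assumes "policy B \<pi>"
  shows "ctx_act_dens \<pi> \<in> borel_measurable U"
proof -
  have [measurable]: "case_prod \<pi> \<in> borel_measurable U" "ctx_dens B \<in> borel_measurable C"
    using assms wf by (auto simp: policy_def cond_density_def wf_bandit_def)
  show ?thesis unfolding ctx_act_dens_def[abs_def] by measurable
qed

lemma nn_integral_ctx_act_dens:
  assumes P: "policy B \<pi>"
  shows "(\<integral>\<^sup>+u. ctx_act_dens \<pi> u \<partial>U) = 1"
proof -
  interpret A: sigma_finite_measure A by (rule refs_sigma_finite)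
  have [measurable]: "case_prod \<pi> \<in> borel_measurable U"
    and one: "\<And>x. x \<in> space C \<Longrightarrow> (\<integral>\<^sup>+a. ennreal (\<pi> x a) \<partial>A) = 1"
    using P by (auto simp: policy_def cond_density_def)
  have "(\<integral>\<^sup>+u. ctx_act_dens \<pi> u \<partial>U) = (\<integral>\<^sup>+x. \<integral>\<^sup>+a. ctx_act_dens \<pi> (x, a) \<partial>A \<partial>C)"
    using P by (intro A.nn_integral_fst[symmetric]) measurable
  also have "\<dots> = (\<integral>\<^sup>+x. ennreal (ctx_dens B x) \<partial>C)"
  proof (rule nn_integral_cong)
    fix x assume [measurable]: "x \<in> space C"
    have "(\<integral>\<^sup>+a. ctx_act_dens \<pi> (x, a) \<partial>A) = (\<integral>\<^sup>+a. ennreal (ctx_dens B x) * ennreal (\<pi> x a) \<partial>A)"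
      using wf \<open>x \<in> space C\<close> by (simp add: ctx_act_dens_def ennreal_mult' wf_bandit_def)
    also have "\<dots> = ennreal (ctx_dens B x) * (\<integral>\<^sup>+a. ennreal (\<pi> x a) \<partial>A)"
      by (rule nn_integral_cmult) measurable
    finally show "(\<integral>\<^sup>+a. ctx_act_dens \<pi> (x, a) \<partial>A) = ennreal (ctx_dens B x)"
      by (simp add: one \<open>x \<in> space C\<close>)
  qed
  also have "\<dots> = 1" using wf by (simp add: wf_bandit_def)
  finally show ?thesis .
qed

text \<open>The joint density puts one \<open>ennreal\<close> around the whole product. Splitting it
  uses that all factors are nonnegative, which is known only for points of the spaces.\<close>

lemma joint_dens_factor:
  assumes "policy B \<pi>" "u \<in> space U" "r \<in> space R" "s \<in> space S" "y \<in> space Y"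
  shows "joint_dens B \<pi> (fst u, snd u, r, s, y)
    = ctx_act_dens \<pi> u * emb1_kernel u r * emb2_kernel r s * out_kernel s y"
proof -
  have "0 \<le> ctx_dens B (fst u)" "0 \<le> \<pi> (fst u) (snd u)"
      "0 \<le> emb1_dens B (fst u) (snd u) r" "0 \<le> emb2_dens B r s" "0 \<le> out_dens B s y"
    using assms wf by (auto simp: wf_bandit_def policy_def cond_density_def space_pair_measure)
  then show ?thesis
    by (simp add: joint_dens_def ctx_act_dens_def emb1_kernel_def emb2_kernel_def out_kernel_def
        ennreal_mult)
qed

lemma joint_dens_factor':
  assumes "policy B \<pi>" "x \<in> space C" "a \<in> space A" "r \<in> space R" "s \<in> space S" "y \<in> space Y"
  shows "joint_dens B \<pi> (x, a, r, s, y)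
    = ctx_act_dens \<pi> (x, a) * emb1_kernel (x, a) r * emb2_kernel r s * out_kernel s y"
  using joint_dens_factor[of \<pi> "(x, a)" r s y] assms by (simp add: space_pair_measure)

lemma measurable_joint_dens [measurable]:
  assumes P [measurable]: "policy B \<pi>"
  shows "joint_dens B \<pi> \<in> borel_measurable (joint_ref B)"
proof (subst measurable_cong)
  show "joint_dens B \<pi> z = (case z of (x, a, r, s, y) \<Rightarrow>
      ctx_act_dens \<pi> (x, a) * emb1_kernel (x, a) r * emb2_kernel r s * out_kernel s y)"
    if "z \<in> space (joint_ref B)" for z
    using that joint_dens_factor'[OF P] by (auto simp: joint_ref_def space_pair_measure)
  have [measurable]: "ctx_act_dens \<pi> \<in> borel_measurable U"
    by (rule measurable_ctx_act_dens[OF P])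
  show "(\<lambda>z. case z of (x, a, r, s, y) \<Rightarrow>
      ctx_act_dens \<pi> (x, a) * emb1_kernel (x, a) r * emb2_kernel r s * out_kernel s y)
    \<in> borel_measurable (joint_ref B)"
    unfolding joint_ref_def by measurable
qed

text \<open>The link between model and chain: Tonelli unfolds the product reference measure into
  iterated integrals, and the density factors into the kernels.\<close>

lemma nn_integral_joint_law:
  assumes P: "policy B \<pi>" and \<phi>: "\<phi> \<in> borel_measurable (joint_ref B)"
  shows "(\<integral>\<^sup>+z. \<phi> z \<partial>joint_law B \<pi>)
    = chain_integral (ctx_act_dens \<pi>) (\<lambda>(u, q). \<phi> (fst u, snd u, q))"
proof -
  have [measurable]: "\<phi> \<in> borel_measurable (C \<Otimes>\<^sub>M A \<Otimes>\<^sub>M R \<Otimes>\<^sub>M S \<Otimes>\<^sub>M Y)"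
    "joint_dens B \<pi> \<in> borel_measurable (C \<Otimes>\<^sub>M A \<Otimes>\<^sub>M R \<Otimes>\<^sub>M S \<Otimes>\<^sub>M Y)"
    using \<phi> measurable_joint_dens[OF P] by (simp_all add: joint_ref_def)
  have sf: "sigma_finite_measure (S \<Otimes>\<^sub>M Y)" "sigma_finite_measure (R \<Otimes>\<^sub>M S \<Otimes>\<^sub>M Y)"
    by (intro sigma_finite_pair_measure refs_sigma_finite)+
  have "(\<integral>\<^sup>+z. \<phi> z \<partial>joint_law B \<pi>)
      = (\<integral>\<^sup>+z. joint_dens B \<pi> z * \<phi> z \<partial>(C \<Otimes>\<^sub>M A \<Otimes>\<^sub>M R \<Otimes>\<^sub>M S \<Otimes>\<^sub>M Y))"
    unfolding joint_law_def joint_ref_def by (rule nn_integral_density) measurable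
  also have "\<dots> = (\<integral>\<^sup>+u. \<integral>\<^sup>+q. joint_dens B \<pi> (fst u, snd u, q) * \<phi> (fst u, snd u, q)
      \<partial>(R \<Otimes>\<^sub>M S \<Otimes>\<^sub>M Y) \<partial>U)"
    by (rule nn_integral_pair_assoc[OF refs_sigma_finite(2) sf(2)]) measurable
  also have "\<dots> = (\<integral>\<^sup>+u. \<integral>\<^sup>+r. \<integral>\<^sup>+q. joint_dens B \<pi> (fst u, snd u, r, q) * \<phi> (fst u, snd u, r, q)
      \<partial>(S \<Otimes>\<^sub>M Y) \<partial>R \<partial>U)"
    by (intro nn_integral_cong sigma_finite_measure.nn_integral_fst[OF sf(1), symmetric]) measurable
  also have "\<dots> = (\<integral>\<^sup>+u. \<integral>\<^sup>+r. \<integral>\<^sup>+s. \<integral>\<^sup>+y. joint_dens B \<pi> (fst u, snd u, r, s, y) *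
      \<phi> (fst u, snd u, r, s, y) \<partial>Y \<partial>S \<partial>R \<partial>U)"
    by (intro nn_integral_cong Y.nn_integral_fst[symmetric]) measurable
  also have "\<dots> = chain_integral (ctx_act_dens \<pi>) (\<lambda>(u, q). \<phi> (fst u, snd u, q))"
    unfolding chain_integral_def using P
    by (intro nn_integral_cong) (simp add: joint_dens_factor)
  finally show ?thesis .
qed

lemma emb1_marg_eq:
  assumes P: "policy B \<pi>" and r [measurable]: "r \<in> space R"
  shows "emb1_marg B \<pi> r = marg1 (ctx_act_dens \<pi>) r"
proof -
  have [measurable]: "ctx_act_dens \<pi> \<in> borel_measurable U"
    by (rule measurable_ctx_act_dens[OF P])
  have sf: "sigma_finite_measure (S \<Otimes>\<^sub>M Y)"
    by (intro sigma_finite_pair_measure refs_sigma_finite)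
  let ?F = "\<lambda>(x, a, s, y). ctx_act_dens \<pi> (x, a) * emb1_kernel (x, a) r * emb2_kernel r s * out_kernel s y"
  have "emb1_marg B \<pi> r = (\<integral>\<^sup>+z. ?F z \<partial>(C \<Otimes>\<^sub>M A \<Otimes>\<^sub>M S \<Otimes>\<^sub>M Y))"
    unfolding emb1_marg_def
    by (intro nn_integral_cong) (auto simp: space_pair_measure joint_dens_factor'[OF P _ _ r])
  also have "\<dots> = (\<integral>\<^sup>+u. \<integral>\<^sup>+q. ?F (fst u, snd u, q) \<partial>(S \<Otimes>\<^sub>M Y) \<partial>U)"
    by (rule nn_integral_pair_assoc[OF refs_sigma_finite(2) sf]) measurable
  also have "\<dots> = (\<integral>\<^sup>+u. \<integral>\<^sup>+s. \<integral>\<^sup>+y. ?F (fst u, snd u, s, y) \<partial>Y \<partial>S \<partial>U)"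
    by (intro nn_integral_cong Y.nn_integral_fst[symmetric]) measurable
  also have "\<dots> = marg1 (ctx_act_dens \<pi>) r"
    by (simp add: marg1_def)
  finally show ?thesis .
qed

lemma emb2_marg_eq:
  assumes P: "policy B \<pi>" and s [measurable]: "s \<in> space S"
  shows "emb2_marg B \<pi> s = marg2 (ctx_act_dens \<pi>) s"
proof -
  have [measurable]: "ctx_act_dens \<pi> \<in> borel_measurable U"
    by (rule measurable_ctx_act_dens[OF P])
  have sf: "sigma_finite_measure (R \<Otimes>\<^sub>M Y)"
    by (intro sigma_finite_pair_measure refs_sigma_finite)
  let ?F = "\<lambda>(x, a, r, y). ctx_act_dens \<pi> (x, a) * emb1_kernel (x, a) r * emb2_kernel r s * out_kernel s y"
  have "emb2_marg B \<pi> s = (\<integral>\<^sup>+z. ?F z \<partial>(C \<Otimes>\<^sub>M A \<Otimes>\<^sub>M R \<Otimes>\<^sub>M Y))"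
    unfolding emb2_marg_def
    by (intro nn_integral_cong) (auto simp: space_pair_measure joint_dens_factor'[OF P _ _ _ s])
  also have "\<dots> = (\<integral>\<^sup>+u. \<integral>\<^sup>+q. ?F (fst u, snd u, q) \<partial>(R \<Otimes>\<^sub>M Y) \<partial>U)"
    by (rule nn_integral_pair_assoc[OF refs_sigma_finite(2) sf]) measurable
  also have "\<dots> = (\<integral>\<^sup>+u. \<integral>\<^sup>+r. \<integral>\<^sup>+y. ?F (fst u, snd u, r, y) \<partial>Y \<partial>R \<partial>U)"
    by (intro nn_integral_cong Y.nn_integral_fst[symmetric]) measurable
  also have "\<dots> = marg2 (ctx_act_dens \<pi>) s"
    by (simp add: marg2_def)
  finally show ?thesis .
qed

lemma out_marg_eq:
  assumes P: "policy B \<pi>" and y [measurable]: "y \<in> space Y"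
  shows "out_marg B \<pi> y = marg3 (ctx_act_dens \<pi>) y"
proof -
  have [measurable]: "ctx_act_dens \<pi> \<in> borel_measurable U"
    by (rule measurable_ctx_act_dens[OF P])
  have sf: "sigma_finite_measure (R \<Otimes>\<^sub>M S)"
    by (intro sigma_finite_pair_measure refs_sigma_finite)
  let ?F = "\<lambda>(x, a, r, s). ctx_act_dens \<pi> (x, a) * emb1_kernel (x, a) r * emb2_kernel r s * out_kernel s y"
  have "out_marg B \<pi> y = (\<integral>\<^sup>+z. ?F z \<partial>(C \<Otimes>\<^sub>M A \<Otimes>\<^sub>M R \<Otimes>\<^sub>M S))"
    unfolding out_marg_def
    by (intro nn_integral_cong) (auto simp: space_pair_measure joint_dens_factor'[OF P _ _ _ _ y])
  also have "\<dots> = (\<integral>\<^sup>+u. \<integral>\<^sup>+q. ?F (fst u, snd u, q) \<partial>(R \<Otimes>\<^sub>M S) \<partial>U)"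
    by (rule nn_integral_pair_assoc[OF refs_sigma_finite(2) sf]) measurable
  also have "\<dots> = (\<integral>\<^sup>+u. \<integral>\<^sup>+r. \<integral>\<^sup>+s. ?F (fst u, snd u, r, s) \<partial>S \<partial>R \<partial>U)"
    by (intro nn_integral_cong S.nn_integral_fst[symmetric]) measurable
  also have "\<dots> = marg3 (ctx_act_dens \<pi>) y"
    by (simp add: marg3_def)
  finally show ?thesis .
qed

lemma measurable_margs:
  assumes P: "policy B \<pi>"
  shows "emb1_marg B \<pi> \<in> borel_measurable R" "emb2_marg B \<pi> \<in> borel_measurable S"
    "out_marg B \<pi> \<in> borel_measurable Y"
  using P by (simp_all add: emb1_marg_eq emb2_marg_eq out_marg_eq
      measurable_marg1 measurable_marg2 measurable_marg3 measurable_ctx_act_dens cong: measurable_cong)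

end

section \<open>The four weights as changes of law from behaviour to target\<close>

locale bandit_policies = bandit_model B for B :: "('x, 'a, 'r, 's) bandit" +
  fixes \<pi>t \<pi>b :: "'x \<Rightarrow> 'a \<Rightarrow> real"
  assumes target: "policy B \<pi>t" and behaviour: "policy B \<pi>b"
    and support: "policy_support B \<pi>t \<pi>b"
begin

text \<open>A zero of the product comes either from the context density, which both policies share,
  or from \<open>\<pi>b\<close>, where the support condition forces \<open>\<pi>t\<close> to
  vanish.\<close>

lemma ctx_act_dens_support:
  assumes "u \<in> space U" "ctx_act_dens \<pi>b u = 0"
  shows "ctx_act_dens \<pi>t u = 0"
proof -
  have *: "fst u \<in> space C" "snd u \<in> space A" using assms by (auto simp: space_pair_measure)
  then have "0 \<le> ctx_dens B (fst u)" "0 \<le> \<pi>b (fst u) (snd u)" "0 \<le> \<pi>t (fst u) (snd u)"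
    using wf target behaviour by (auto simp: wf_bandit_def policy_def cond_density_def)
  moreover have "\<pi>t (fst u) (snd u) > 0 \<longrightarrow> \<pi>b (fst u) (snd u) > 0"
    using support * by (auto simp: policy_support_def)
  ultimately show ?thesis
    using assms(2) by (auto simp: ctx_act_dens_def ennreal_eq_0_iff mult_le_0_iff)
qed

lemmas chain_facts = measurable_ctx_act_dens[OF target] measurable_ctx_act_dens[OF behaviour]
  nn_integral_ctx_act_dens[OF target] nn_integral_ctx_act_dens[OF behaviour] ctx_act_dens_support

lemma measurable_ratios [measurable]:
  shows "(\<lambda>(x, a). policy_ratio \<pi>t \<pi>b a x) \<in> borel_measurable U"
    "emb1_ratio B \<pi>t \<pi>b \<in> borel_measurable R"
    "emb2_ratio B \<pi>t \<pi>b \<in> borel_measurable S" "out_ratio B \<pi>t \<pi>b \<in> borel_measurable Y"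
proof -
  note [measurable] = measurable_margs[OF target] measurable_margs[OF behaviour]
  have [measurable]: "case_prod \<pi>t \<in> borel_measurable U" "case_prod \<pi>b \<in> borel_measurable U"
    using target behaviour by (auto simp: policy_def cond_density_def)
  show "(\<lambda>(x, a). policy_ratio \<pi>t \<pi>b a x) \<in> borel_measurable U"
    unfolding policy_ratio_def by measurable
  show "emb1_ratio B \<pi>t \<pi>b \<in> borel_measurable R"
    unfolding emb1_ratio_def[abs_def] by measurable
  show "emb2_ratio B \<pi>t \<pi>b \<in> borel_measurable S"
    unfolding emb2_ratio_def[abs_def] by measurable
  show "out_ratio B \<pi>t \<pi>b \<in> borel_measurable Y"
    unfolding out_ratio_def[abs_def] by measurable
qed

text \<open>No marginalization occurs here: the weight turns one joint density into the other at
  every point.\<close>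

lemma nn_integral_policy_ratio:
  assumes \<phi> [measurable]: "\<phi> \<in> borel_measurable (joint_ref B)"
  shows "(\<integral>\<^sup>+(x, a, q). ennreal (policy_ratio \<pi>t \<pi>b a x) * \<phi> (x, a, q) \<partial>joint_law B \<pi>b)
    = (\<integral>\<^sup>+z. \<phi> z \<partial>joint_law B \<pi>t)"
proof -
  note [measurable] = measurable_joint_dens[OF target] measurable_joint_dens[OF behaviour]
  have \<phi>' [measurable]: "\<phi> \<in> borel_measurable (C \<Otimes>\<^sub>M A \<Otimes>\<^sub>M R \<Otimes>\<^sub>M S \<Otimes>\<^sub>M Y)"
    using \<phi> by (simp add: joint_ref_def)
  have [measurable]: "(\<lambda>(x, a, q). ennreal (policy_ratio \<pi>t \<pi>b a x) * \<phi> (x, a, q))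
      \<in> borel_measurable (joint_ref B)"
  proof -
    have "(\<lambda>z. ennreal ((\<lambda>(x, a). policy_ratio \<pi>t \<pi>b a x) (fst z, fst (snd z))) * \<phi> z)
        \<in> borel_measurable (C \<Otimes>\<^sub>M A \<Otimes>\<^sub>M R \<Otimes>\<^sub>M S \<Otimes>\<^sub>M Y)"
      by measurable
    then show ?thesis by (simp add: case_prod_unfold joint_ref_def)
  qed
  have "(\<integral>\<^sup>+(x, a, q). ennreal (policy_ratio \<pi>t \<pi>b a x) * \<phi> (x, a, q) \<partial>joint_law B \<pi>b)
      = (\<integral>\<^sup>+z. joint_dens B \<pi>b z * (case z of (x, a, q) \<Rightarrow> ennreal (policy_ratio \<pi>t \<pi>b a x) * \<phi> (x, a, q))
          \<partial>joint_ref B)"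
    unfolding joint_law_def by (rule nn_integral_density) measurable
  also have "\<dots> = (\<integral>\<^sup>+z. joint_dens B \<pi>t z * \<phi> z \<partial>joint_ref B)"
  proof (rule nn_integral_cong)
    fix z assume z: "z \<in> space (joint_ref B)"
    obtain x a r s y where [simp]: "z = (x, a, r, s, y)" by (metis surj_pair)
    have *: "x \<in> space C" "a \<in> space A"
      using z by (auto simp: joint_ref_def space_pair_measure)
    then have "0 \<le> \<pi>b x a" "0 \<le> \<pi>t x a"
      using target behaviour by (auto simp: policy_def cond_density_def)
    moreover have "\<pi>t x a > 0 \<longrightarrow> \<pi>b x a > 0"
      using support * by (auto simp: policy_support_def)
    \<comment> \<open>If \<open>\<pi>b\<close> is 0, then so is \<open>\<pi>t\<close> by support,
      and the quotient is 0 by convention; the identity thus has no exception.\<close>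
    ultimately have eq: "\<pi>b x a * policy_ratio \<pi>t \<pi>b a x = \<pi>t x a"
        and nonneg: "0 \<le> policy_ratio \<pi>t \<pi>b a x"
      by (auto simp: policy_ratio_def)
    have "joint_dens B \<pi>b z * ennreal (policy_ratio \<pi>t \<pi>b a x)
        = ennreal (ctx_dens B x * \<pi>b x a * emb1_dens B x a r * emb2_dens B r s * out_dens B s y *
            policy_ratio \<pi>t \<pi>b a x)"
      using nonneg by (simp add: joint_dens_def ennreal_mult'')
    also have "\<dots> = ennreal (ctx_dens B x * (\<pi>b x a * policy_ratio \<pi>t \<pi>b a x) *
        emb1_dens B x a r * emb2_dens B r s * out_dens B s y)"
      by (simp only: mult_ac)
    also have "\<dots> = joint_dens B \<pi>t z"
      by (simp only: eq) (simp add: joint_dens_def)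
    finally have "joint_dens B \<pi>b z * ennreal (policy_ratio \<pi>t \<pi>b a x) = joint_dens B \<pi>t z" .
    then show "joint_dens B \<pi>b z * (case z of (x, a, q) \<Rightarrow> ennreal (policy_ratio \<pi>t \<pi>b a x) * \<phi> (x, a, q))
        = joint_dens B \<pi>t z * \<phi> z"
      by (simp add: mult.assoc[symmetric])
  qed
  also have "\<dots> = (\<integral>\<^sup>+z. \<phi> z \<partial>joint_law B \<pi>t)"
    unfolding joint_law_def by (rule nn_integral_density[symmetric]) measurable
  finally show ?thesis .
qed

lemma nn_integral_emb1_ratio:
  assumes [measurable]: "\<phi> \<in> borel_measurable (R \<Otimes>\<^sub>M S \<Otimes>\<^sub>M Y)"
  shows "(\<integral>\<^sup>+(x, a, r, q). ennreal (emb1_ratio B \<pi>t \<pi>b r) * \<phi> (r, q) \<partial>joint_law B \<pi>b)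
    = (\<integral>\<^sup>+(x, a, q). \<phi> q \<partial>joint_law B \<pi>t)"
proof -
  have "(\<integral>\<^sup>+(x, a, r, q). ennreal (emb1_ratio B \<pi>t \<pi>b r) * \<phi> (r, q) \<partial>joint_law B \<pi>b)
      = chain_integral (ctx_act_dens \<pi>b) (\<lambda>(u, r, q). ennreal (emb1_ratio B \<pi>t \<pi>b r) * \<phi> (r, q))"
    by (subst nn_integral_joint_law[OF behaviour])
       (simp_all add: joint_ref_def case_prod_unfold)
  also have "\<dots> = chain_integral (ctx_act_dens \<pi>b) (\<lambda>(u, r, q). ennreal
      (enn2real (marg1 (ctx_act_dens \<pi>t) r) / enn2real (marg1 (ctx_act_dens \<pi>b) r)) * \<phi> (r, q))"
    \<comment> \<open>The marginals of the model and of the chain agree on the spaces, so the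
      rewriting takes place under the integral signs.\<close>
    unfolding chain_integral_def
    by (intro nn_integral_cong) (simp add: emb1_ratio_def emb1_marg_eq target behaviour)
  also have "\<dots> = chain_integral (ctx_act_dens \<pi>t) (\<lambda>(u, q). \<phi> q)"
    by (rule chain_integral_weight1) (simp_all add: chain_facts)
  also have "\<dots> = (\<integral>\<^sup>+(x, a, q). \<phi> q \<partial>joint_law B \<pi>t)"
    by (subst nn_integral_joint_law[OF target]) (simp_all add: joint_ref_def case_prod_unfold)
  finally show ?thesis .
qed

lemma nn_integral_emb2_ratio:
  assumes [measurable]: "\<phi> \<in> borel_measurable (S \<Otimes>\<^sub>M Y)"
  shows "(\<integral>\<^sup>+(x, a, r, s, y). ennreal (emb2_ratio B \<pi>t \<pi>b s) * \<phi> (s, y) \<partial>joint_law B \<pi>b)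
    = (\<integral>\<^sup>+(x, a, r, q). \<phi> q \<partial>joint_law B \<pi>t)"
proof -
  have "(\<integral>\<^sup>+(x, a, r, s, y). ennreal (emb2_ratio B \<pi>t \<pi>b s) * \<phi> (s, y) \<partial>joint_law B \<pi>b)
      = chain_integral (ctx_act_dens \<pi>b) (\<lambda>(u, r, s, y). ennreal (emb2_ratio B \<pi>t \<pi>b s) * \<phi> (s, y))"
    by (subst nn_integral_joint_law[OF behaviour])
       (simp_all add: joint_ref_def case_prod_unfold)
  also have "\<dots> = chain_integral (ctx_act_dens \<pi>b) (\<lambda>(u, r, s, y). ennreal
      (enn2real (marg2 (ctx_act_dens \<pi>t) s) / enn2real (marg2 (ctx_act_dens \<pi>b) s)) * \<phi> (s, y))"
    unfolding chain_integral_def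
    by (intro nn_integral_cong) (simp add: emb2_ratio_def emb2_marg_eq target behaviour)
  also have "\<dots> = chain_integral (ctx_act_dens \<pi>t) (\<lambda>(u, r, q). \<phi> q)"
    by (rule chain_integral_weight2) (simp_all add: chain_facts)
  also have "\<dots> = (\<integral>\<^sup>+(x, a, r, q). \<phi> q \<partial>joint_law B \<pi>t)"
    by (subst nn_integral_joint_law[OF target]) (simp_all add: joint_ref_def case_prod_unfold)
  finally show ?thesis .
qed

lemma nn_integral_out_ratio:
  assumes [measurable]: "\<phi> \<in> borel_measurable Y"
  shows "(\<integral>\<^sup>+(x, a, r, s, y). ennreal (out_ratio B \<pi>t \<pi>b y) * \<phi> y \<partial>joint_law B \<pi>b)
    = (\<integral>\<^sup>+(x, a, r, s, y). \<phi> y \<partial>joint_law B \<pi>t)"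
proof -
  have "(\<integral>\<^sup>+(x, a, r, s, y). ennreal (out_ratio B \<pi>t \<pi>b y) * \<phi> y \<partial>joint_law B \<pi>b)
      = chain_integral (ctx_act_dens \<pi>b) (\<lambda>(u, r, s, y). ennreal (out_ratio B \<pi>t \<pi>b y) * \<phi> y)"
    by (subst nn_integral_joint_law[OF behaviour])
       (simp_all add: joint_ref_def case_prod_unfold)
  also have "\<dots> = chain_integral (ctx_act_dens \<pi>b) (\<lambda>(u, r, s, y). ennreal
      (enn2real (marg3 (ctx_act_dens \<pi>t) y) / enn2real (marg3 (ctx_act_dens \<pi>b) y)) * \<phi> y)"
    unfolding chain_integral_def
    by (intro nn_integral_cong) (simp add: out_ratio_def out_marg_eq target behaviour)
  also have "\<dots> = chain_integral (ctx_act_dens \<pi>t) (\<lambda>(u, r, s, y). \<phi> y)"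
    by (rule chain_integral_weight3) (simp_all add: chain_facts)
  also have "\<dots> = (\<integral>\<^sup>+(x, a, r, s, y). \<phi> y \<partial>joint_law B \<pi>t)"
    by (subst nn_integral_joint_law[OF target]) (simp_all add: joint_ref_def case_prod_unfold)
  finally show ?thesis .
qed

end

section \<open>Comparison of the estimators\<close>

text \<open>The terms \<open>F (Z i)\<close> are again independent, with common law the image of
  \<open>joint_law B \<pi>\<close> under \<open>F\<close>; the moments of this image are integrals
  over the joint law.\<close>

lemma (in prob_space) iid_sample_mean_moments:
  fixes F :: "'x \<times> 'c \<times> 'r \<times> 's \<times> real \<Rightarrow> real"
  assumes iid: "iid_sample B \<pi> n M Z" and n: "n \<ge> 1"
    and F [measurable]: "F \<in> borel_measurable (joint_ref B)"
    and int: "integrable (joint_law B \<pi>) F"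
    and fin: "finite_mean_var M (\<lambda>\<omega>. 1 / real n * (\<Sum>i=1..n. F (Z i \<omega>)))"
  shows "expectation (\<lambda>\<omega>. 1 / real n * (\<Sum>i=1..n. F (Z i \<omega>))) = (\<integral>z. F z \<partial>joint_law B \<pi>)"
    and "integrable (joint_law B \<pi>) (\<lambda>z. (F z)\<^sup>2)"
    and "variance (\<lambda>\<omega>. 1 / real n * (\<Sum>i=1..n. F (Z i \<omega>)))
      = ((\<integral>z. (F z)\<^sup>2 \<partial>joint_law B \<pi>) - (\<integral>z. F z \<partial>joint_law B \<pi>)\<^sup>2) / real n"
proof -
  let ?D = "distr (joint_law B \<pi>) borel F"
  have F' [measurable]: "F \<in> borel_measurable (joint_law B \<pi>)"
    using F by (simp add: joint_law_def)
  have ind: "indep_vars (\<lambda>_. borel) (\<lambda>i \<omega>. F (Z i \<omega>)) {1..n}"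
    using iid by (intro indep_vars_compose2[where M' = "\<lambda>_. joint_ref B", OF _ F]) (simp add: iid_sample_def)
  have D: "distr M borel (\<lambda>\<omega>. F (Z i \<omega>)) = ?D" if "i \<in> {1..n}" for i
  proof -
    have d: "distributed M (joint_ref B) (Z i) (joint_dens B \<pi>)"
      using iid that by (auto simp: iid_sample_def)
    note [measurable] = distributed_measurable[OF d]
    have "distr M borel (\<lambda>\<omega>. F (Z i \<omega>)) = distr (distr M (joint_ref B) (Z i)) borel F"
      by (subst distr_distr) (simp_all add: comp_def)
    then show ?thesis
      by (simp add: distributed_distr_eq_density[OF d] joint_law_def)
  qed
  have intD: "integrable ?D (\<lambda>x. x)"
    using int by (simp add: integrable_distr_eq)
  note * = iid_mean_moments[OF n ind D intD fin]
  show "expectation (\<lambda>\<omega>. 1 / real n * (\<Sum>i=1..n. F (Z i \<omega>))) = (\<integral>z. F z \<partial>joint_law B \<pi>)"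
    using *(1) by (simp add: integral_distr)
  show "integrable (joint_law B \<pi>) (\<lambda>z. (F z)\<^sup>2)"
    using *(2) by (simp add: integrable_distr_eq)
  show "variance (\<lambda>\<omega>. 1 / real n * (\<Sum>i=1..n. F (Z i \<omega>)))
      = ((\<integral>z. (F z)\<^sup>2 \<partial>joint_law B \<pi>) - (\<integral>z. F z \<partial>joint_law B \<pi>)\<^sup>2) / real n"
    using *(3) by (simp add: integral_distr)
qed

theorem propositionD4:
  fixes B :: "('x, 'a, 'r, 's) bandit"
    and \<pi>t \<pi>b :: "'x \<Rightarrow> 'a \<Rightarrow> real"
    and n :: nat
    and M :: "'w measure"
    and Z :: "nat \<Rightarrow> 'w \<Rightarrow> 'x \<times> 'a \<times> 'r \<times> 's \<times> real"
  assumes "wf_bandit B"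
    and "policy B \<pi>t" and "policy B \<pi>b"
    and "policy_support B \<pi>t \<pi>b"
    and "n \<ge> 1"
    and "iid_sample B \<pi>b n M Z"
    and "finite_mean_var M (theta_IPW \<pi>t \<pi>b n Z)"
    and "finite_mean_var M (theta_GMIPS1 B \<pi>t \<pi>b n Z)"
    and "finite_mean_var M (theta_GMIPS2 B \<pi>t \<pi>b n Z)"
    and "finite_mean_var M (theta_MR B \<pi>t \<pi>b n Z)"
    and "integrable (joint_law B \<pi>t) (\<lambda>(x, a, r, s, y). y)"
  shows "prob_space.expectation M (theta_IPW \<pi>t \<pi>b n Z)
           = (\<integral>(x, a, r, s, y). y \<partial>joint_law B \<pi>t)
       \<and> prob_space.expectation M (theta_GMIPS1 B \<pi>t \<pi>b n Z)
           = (\<integral>(x, a, r, s, y). y \<partial>joint_law B \<pi>t)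
       \<and> prob_space.expectation M (theta_GMIPS2 B \<pi>t \<pi>b n Z)
           = (\<integral>(x, a, r, s, y). y \<partial>joint_law B \<pi>t)
       \<and> prob_space.expectation M (theta_MR B \<pi>t \<pi>b n Z)
           = (\<integral>(x, a, r, s, y). y \<partial>joint_law B \<pi>t)
       \<and> prob_space.variance M (theta_IPW \<pi>t \<pi>b n Z)
           \<ge> prob_space.variance M (theta_GMIPS1 B \<pi>t \<pi>b n Z)
       \<and> prob_space.variance M (theta_GMIPS1 B \<pi>t \<pi>b n Z)
           \<ge> prob_space.variance M (theta_GMIPS2 B \<pi>t \<pi>b n Z)
       \<and> prob_space.variance M (theta_GMIPS2 B \<pi>t \<pi>b n Z)
           \<ge> prob_space.variance M (theta_MR B \<pi>t \<pi>b n Z)"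
proof -
  note n = assms(5) and iid = assms(6)
  interpret bandit_policies B \<pi>t \<pi>b
    using assms(1-4) by unfold_locales
  interpret M: prob_space M using iid by (simp add: iid_sample_def)
  let ?Pb = "joint_law B \<pi>b" and ?Pt = "joint_law B \<pi>t"
  let ?y = "\<lambda>z::'x \<times> 'a \<times> 'r \<times> 's \<times> real. snd (snd (snd (snd z)))"
  let ?W0 = "\<lambda>z::'x \<times> 'a \<times> 'r \<times> 's \<times> real. policy_ratio \<pi>t \<pi>b (fst (snd z)) (fst z)"
  let ?W1 = "\<lambda>z::'x \<times> 'a \<times> 'r \<times> 's \<times> real. emb1_ratio B \<pi>t \<pi>b (fst (snd (snd z)))"
  let ?W2 = "\<lambda>z::'x \<times> 'a \<times> 'r \<times> 's \<times> real. emb2_ratio B \<pi>t \<pi>b (fst (snd (snd (snd z))))"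
  let ?W3 = "\<lambda>z::'x \<times> 'a \<times> 'r \<times> 's \<times> real. out_ratio B \<pi>t \<pi>b (?y z)"
  \<comment> \<open>The outcome space carries the trace of the Borel sets, so the identity into the
    reals is measurable as a restriction.\<close>
  have Y [measurable]: "(\<lambda>y. y) \<in> borel_measurable Y"
  proof -
    have "sets Y = sets (restrict_space borel (space Y))"
      using assms(1) unfolding wf_bandit_def by blast
    then show ?thesis
      by (subst measurable_cong_sets) (auto intro: measurable_restrict_space1)
  qed
  have y: "?y \<in> borel_measurable (joint_ref B)"
    unfolding joint_ref_def by (rule measurable_compose[OF _ Y]) measurable
  have W0: "?W0 \<in> borel_measurable (joint_ref B)"
  proof -
    have "(\<lambda>z. (\<lambda>(x, a). policy_ratio \<pi>t \<pi>b a x) (fst z, fst (snd z))) \<in> borel_measurable (joint_ref B)"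
      unfolding joint_ref_def by measurable
    then show ?thesis by simp
  qed
  have W: "?W1 \<in> borel_measurable (joint_ref B)" "?W2 \<in> borel_measurable (joint_ref B)"
      "?W3 \<in> borel_measurable (joint_ref B)"
    unfolding joint_ref_def by measurable
  have meas_b: "f \<in> borel_measurable (joint_ref B) \<Longrightarrow> f \<in> borel_measurable ?Pb" for f :: "_ \<Rightarrow> real"
    by (simp add: joint_law_def)
  have space_Pb: "space ?Pb = space (joint_ref B)"
    by (simp add: joint_law_def)
  \<comment> \<open>Policies are nonnegative only on the spaces, so this holds only there; the other
    weights are quotients of values of \<open>enn2real\<close> and are nonnegative
    everywhere.\<close>
  have nonneg0: "0 \<le> ?W0 z" if "z \<in> space ?Pb" for z
    using that assms(2,3) unfolding space_Pb
    by (auto simp: joint_ref_def space_pair_measure policy_ratio_def policy_def cond_density_def)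
  have nonneg: "0 \<le> ?W1 z" "0 \<le> ?W2 z" "0 \<le> ?W3 z" for z
    by (simp_all add: emb1_ratio_def emb2_ratio_def out_ratio_def)
  have int_y: "integrable ?Pt ?y"
    using assms(11) by (simp add: case_prod_unfold)

  \<comment> \<open>From \<open>change0\<close> to \<open>change3\<close> the test function may
    depend on fewer and fewer variables: all of them, those from the first embedding on, those from
    the second embedding on, and the outcome alone.\<close>
  have change0: "(\<integral>\<^sup>+z. ennreal (?W0 z) * \<phi> z \<partial>?Pb) = (\<integral>\<^sup>+z. \<phi> z \<partial>?Pt)"
    if "\<phi> \<in> borel_measurable (joint_ref B)" for \<phi>
    using nn_integral_policy_ratio[OF that] by (simp add: case_prod_unfold)
  have change1: "(\<integral>\<^sup>+z. ennreal (?W1 z) * \<phi> (snd (snd z)) \<partial>?Pb) = (\<integral>\<^sup>+z. \<phi> (snd (snd z)) \<partial>?Pt)"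
    if "\<phi> \<in> borel_measurable (R \<Otimes>\<^sub>M S \<Otimes>\<^sub>M Y)" for \<phi>
    using nn_integral_emb1_ratio[OF that] by (simp add: case_prod_unfold)
  have change2: "(\<integral>\<^sup>+z. ennreal (?W2 z) * \<phi> (snd (snd (snd z))) \<partial>?Pb) = (\<integral>\<^sup>+z. \<phi> (snd (snd (snd z))) \<partial>?Pt)"
    if "\<phi> \<in> borel_measurable (S \<Otimes>\<^sub>M Y)" for \<phi>
    using nn_integral_emb2_ratio[OF that] by (simp add: case_prod_unfold)
  have change3: "(\<integral>\<^sup>+z. ennreal (?W3 z) * \<phi> (?y z) \<partial>?Pb) = (\<integral>\<^sup>+z. \<phi> (?y z) \<partial>?Pt)"
    if "\<phi> \<in> borel_measurable Y" for \<phi>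
    using nn_integral_out_ratio[OF that] by (simp add: case_prod_unfold)

  have y1: "(\<lambda>q::'r \<times> 's \<times> real. snd (snd q)) \<in> borel_measurable (R \<Otimes>\<^sub>M S \<Otimes>\<^sub>M Y)"
    and y2: "(\<lambda>q::'s \<times> real. snd q) \<in> borel_measurable (S \<Otimes>\<^sub>M Y)"
    by (rule measurable_compose[OF _ Y], measurable)+
  note [measurable] = y1 y2 y W0 W
  define T where "T w \<omega> = 1 / real n * (\<Sum>i=1..n. w (Z i \<omega>) * ?y (Z i \<omega>))" for w \<omega>
  have T: "theta_IPW \<pi>t \<pi>b n Z = T ?W0" "theta_GMIPS1 B \<pi>t \<pi>b n Z = T ?W1"
      "theta_GMIPS2 B \<pi>t \<pi>b n Z = T ?W2" "theta_MR B \<pi>t \<pi>b n Z = T ?W3"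
    by (simp_all add: fun_eq_iff T_def theta_IPW_def theta_GMIPS1_def theta_GMIPS2_def theta_MR_def
        case_prod_unfold)
  \<comment> \<open>These are the properties the four weights share, so that mean and variance need
    to be computed only once. The two integral equations are the change of law for the positive and
    the negative part of the outcome.\<close>
  define weight where "weight w \<longleftrightarrow> w \<in> borel_measurable (joint_ref B) \<and>
      (\<forall>z\<in>space ?Pb. 0 \<le> w z) \<and> finite_mean_var M (T w) \<and>
      (\<integral>\<^sup>+z. ennreal (w z) * ennreal (?y z) \<partial>?Pb) = (\<integral>\<^sup>+z. ennreal (?y z) \<partial>?Pt) \<and>
      (\<integral>\<^sup>+z. ennreal (w z) * ennreal (- ?y z) \<partial>?Pb) = (\<integral>\<^sup>+z. ennreal (- ?y z) \<partial>?Pt)" for w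
  have weight: "weight ?W0" "weight ?W1" "weight ?W2" "weight ?W3"
    unfolding weight_def
    using W0 W nonneg0 nonneg assms(7-10)[unfolded T]
      change0[of "\<lambda>z. ennreal (?y z)"] change0[of "\<lambda>z. ennreal (- ?y z)"]
      change1[of "\<lambda>q. ennreal (snd (snd q))"] change1[of "\<lambda>q. ennreal (- snd (snd q))"]
      change2[of "\<lambda>q. ennreal (snd q)"] change2[of "\<lambda>q. ennreal (- snd q)"]
      change3[of "\<lambda>y. ennreal y"] change3[of "\<lambda>y. ennreal (- y)"]
    by simp_all
  have moments: "M.expectation (T w) = (\<integral>z. ?y z \<partial>?Pt)" "integrable ?Pb (\<lambda>z. (w z * ?y z)\<^sup>2)"
      "M.variance (T w) = ((\<integral>z. (w z * ?y z)\<^sup>2 \<partial>?Pb) - (\<integral>z. ?y z \<partial>?Pt)\<^sup>2) / real n"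
    if w: "weight w" for w
  proof -
    have mean: "integrable ?Pb (\<lambda>z. w z * ?y z)" "(\<integral>z. w z * ?y z \<partial>?Pb) = (\<integral>z. ?y z \<partial>?Pt)"
      using w by (auto simp: weight_def intro!: weighted_mean_transfer meas_b y int_y)
    have "(\<lambda>z. w z * ?y z) \<in> borel_measurable (joint_ref B)"
      using w y by (intro borel_measurable_times) (simp_all add: weight_def)
    moreover have "finite_mean_var M (\<lambda>\<omega>. 1 / real n * (\<Sum>i=1..n. w (Z i \<omega>) * ?y (Z i \<omega>)))"
      using w by (simp only: weight_def T_def[abs_def])
    ultimately show "M.expectation (T w) = (\<integral>z. ?y z \<partial>?Pt)" "integrable ?Pb (\<lambda>z. (w z * ?y z)\<^sup>2)"
      "M.variance (T w) = ((\<integral>z. (w z * ?y z)\<^sup>2 \<partial>?Pb) - (\<integral>z. ?y z \<partial>?Pt)\<^sup>2) / real n"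
      using M.iid_sample_mean_moments[OF iid n, of "\<lambda>z. w z * ?y z"] mean(1)
      unfolding T_def[abs_def] mean(2) by blast+
  qed

  \<comment> \<open>All four estimators have the same mean, so their variances are ordered as the
    second moments of a single term.\<close>
  have le: "M.variance (T v) \<le> M.variance (T u)"
    if u: "weight u" and v: "weight v"
      and orth: "(\<integral>\<^sup>+z. ennreal (u z) * ennreal (v z * (?y z)\<^sup>2) \<partial>?Pb)
        = (\<integral>\<^sup>+z. ennreal (v z) * ennreal (v z * (?y z)\<^sup>2) \<partial>?Pb)" for u v
  proof -
    have "(\<integral>z. (v z * ?y z)\<^sup>2 \<partial>?Pb) \<le> (\<integral>z. (u z * ?y z)\<^sup>2 \<partial>?Pb)"
      using u v orth moments(2)[OF u] moments(2)[OF v]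
      by (intro projected_weight_second_moment_le meas_b y) (simp_all add: weight_def)
    then show ?thesis
      unfolding moments(3)[OF u] moments(3)[OF v] by (intro divide_right_mono diff_right_mono) simp_all
  qed
  have "M.variance (T ?W1) \<le> M.variance (T ?W0)"
    using change0[of "\<lambda>z. ennreal (?W1 z * (?y z)\<^sup>2)"]
      change1[of "\<lambda>q. ennreal (emb1_ratio B \<pi>t \<pi>b (fst q) * (snd (snd q))\<^sup>2)"]
    by (intro le weight) simp_all
  moreover have "M.variance (T ?W2) \<le> M.variance (T ?W1)"
    using change1[of "\<lambda>q. ennreal (emb2_ratio B \<pi>t \<pi>b (fst (snd q)) * (snd (snd q))\<^sup>2)"]
      change2[of "\<lambda>q. ennreal (emb2_ratio B \<pi>t \<pi>b (fst q) * (snd q)\<^sup>2)"]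
    by (intro le weight) simp_all
  moreover have "M.variance (T ?W3) \<le> M.variance (T ?W2)"
    using change2[of "\<lambda>q. ennreal (out_ratio B \<pi>t \<pi>b (snd q) * (snd q)\<^sup>2)"]
      change3[of "\<lambda>y. ennreal (out_ratio B \<pi>t \<pi>b y * y\<^sup>2)"]
    by (intro le weight) simp_all
  moreover have "(\<integral>(x, a, r, s, y). y \<partial>?Pt) = (\<integral>z. ?y z \<partial>?Pt)"
    by (simp add: case_prod_unfold)
  ultimately show ?thesis
    unfolding T by (simp only: moments(1)[OF weight(1)] moments(1)[OF weight(2)] moments(1)[OF weight(3)]
        moments(1)[OF weight(4)] simp_thms)
qed

end
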